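(* Let $n\ge 1$, let $\mathcal{C}$ be an abelian category with enough projectives, and let $(\mathcal{A},\mathcal{B})$ be a left $n$-cotorsion pair in $\mathcal{C}$. If the equality $\mathcal{A}={}^{\perp_1}\mathcal{B}$ holds, then the following conditions are equivalent for any integer $0\le k\le n-1$: (a) Every object in $\mathcal{C}$ has a ${}^{\perp_{k+1}}\mathcal{B}$-precover with the unique mapping property. (b) $\mathrm{resdim}_{\mathcal{A}}(\mathcal{C})\le k$, that is, every object of $\mathcal{C}$ has $\mathcal{A}$-resolution dimension at most $k$. (c) $\mathcal{C}={}^{\perp_{k+1}}\mathcal{B}$.
   Context: $\mathrm{Ext}^i_{\mathcal{C}}(\mathcal{A},\mathcal{B})=0$ means $\mathrm{Ext}^i_{\mathcal{C}}(A,B)=0$ for all $A\in\mathcal{A}$, $B\in\mathcal{B}$. ${}^{\perp_i}\mathcal{B}=\{X:\mathrm{Ext}^i_{\mathcal{C}}(X,\mathcal{B})=0\}$. For a class $\mathcal{X}$, the $\mathcal{X}$-resolution dimension of $C$ is the smallest $m\ge0$ for which there is an exact sequence $0\to X_m\to\cdots\to X_0\to C\to 0$ with all $X_j\in\mathcal{X}$ ($\infty$ if none exists); $\mathcal{X}^\wedge_m$ is the class of objects of $\mathcal{X}$-resolution dimension $\le m$. Left $n$-cotorsion pair $(\mathcal{A},\mathcal{B})$: (1) $\mathcal{A}$ is closed under direct summands; (2) $\mathrm{Ext}^i_{\mathcal{C}}(\mathcal{A},\mathcal{B})=0$ for $1\le i\le n$; (3) for every $C\in\mathcal{C}$ there is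 a short exact sequence $0\to K\to A\to C\to 0$ with $A\in\mathcal{A}$ and $K\in\mathcal{B}^\wedge_{n-1}$. An $\mathcal{X}$-precover of $C$ is a morphism $f:X\to C$ with $X\in\mathcal{X}$ such that every $f':X'\to C$ with $X'\in\mathcal{X}$ is of the form $f'=f\circ h$ for some $h:X'\to X$; it has the unique mapping property if such an $h$ is always unique. *)

theory Defs
  imports "HOL-Algebra.Elementary_Groups" "HOL-Library.Extended_Nat"
begin

section \<open>Preadditive and abelian categories\<close>

record ('o, 'm) precat =
  Obj :: "'o set"
  Arr :: "'m set"
  Dom :: "'m \<Rightarrow> 'o"
  Cod :: "'m \<Rightarrow> 'o"
  Id :: "'o \<Rightarrow> 'm"
  Comp :: "'m \<Rightarrow> 'm \<Rightarrow> 'm"  (infixl "\<cdot>\<index>" 70)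
  Add :: "'m \<Rightarrow> 'm \<Rightarrow> 'm"
  Zero :: "'o \<Rightarrow> 'o \<Rightarrow> 'm"

text \<open>Composition is written in the usual order: \<open>g \<cdot>\<^bsub>C\<^esub> f\<close> is \<open>g\<close> after \<open>f\<close>.
  Values of the operations on arguments outside the intended domain are irrelevant.\<close>

definition homset :: "('o, 'm) precat \<Rightarrow> 'o \<Rightarrow> 'o \<Rightarrow> 'm set" where
  "homset C X Y = {f \<in> Arr C. Dom C f = X \<and> Cod C f = Y}"

definition hom_group :: "('o, 'm) precat \<Rightarrow> 'o \<Rightarrow> 'o \<Rightarrow> 'm monoid" where
  "hom_group C X Y = \<lparr>carrier = homset C X Y, monoid.mult = Add C, one = Zero C X Y\<rparr>"

definition zero_object :: "('o, 'm) precat \<Rightarrow> 'o \<Rightarrow> bool" where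
  "zero_object C Z \<longleftrightarrow> Z \<in> Obj C \<and>
     (\<forall>X \<in> Obj C. (\<exists>!f. f \<in> homset C Z X) \<and> (\<exists>!f. f \<in> homset C X Z))"

definition monic :: "('o, 'm) precat \<Rightarrow> 'm \<Rightarrow> bool" where
  "monic C f \<longleftrightarrow> f \<in> Arr C \<and>
     (\<forall>X \<in> Obj C. \<forall>g \<in> homset C X (Dom C f). \<forall>h \<in> homset C X (Dom C f).
        f \<cdot>\<^bsub>C\<^esub> g = f \<cdot>\<^bsub>C\<^esub> h \<longrightarrow> g = h)"

definition epic :: "('o, 'm) precat \<Rightarrow> 'm \<Rightarrow> bool" where
  "epic C f \<longleftrightarrow> f \<in> Arr C \<and>
     (\<forall>X \<in> Obj C. \<forall>g \<in> homset C (Cod C f) X. \<forall>h \<in> homset C (Cod C f) X.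
        g \<cdot>\<^bsub>C\<^esub> f = h \<cdot>\<^bsub>C\<^esub> f \<longrightarrow> g = h)"

definition is_kernel :: "('o, 'm) precat \<Rightarrow> 'm \<Rightarrow> 'm \<Rightarrow> bool" where
  "is_kernel C f m \<longleftrightarrow> f \<in> Arr C \<and> m \<in> Arr C \<and> Cod C m = Dom C f \<and>
     f \<cdot>\<^bsub>C\<^esub> m = Zero C (Dom C m) (Cod C f) \<and>
     (\<forall>X \<in> Obj C. \<forall>x \<in> homset C X (Dom C f). f \<cdot>\<^bsub>C\<^esub> x = Zero C X (Cod C f) \<longrightarrow>
        (\<exists>!h. h \<in> homset C X (Dom C m) \<and> m \<cdot>\<^bsub>C\<^esub> h = x))"

definition is_cokernel :: "('o, 'm) precat \<Rightarrow> 'm \<Rightarrow> 'm \<Rightarrow> bool" where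
  "is_cokernel C f q \<longleftrightarrow> f \<in> Arr C \<and> q \<in> Arr C \<and> Dom C q = Cod C f \<and>
     q \<cdot>\<^bsub>C\<^esub> f = Zero C (Dom C f) (Cod C q) \<and>
     (\<forall>X \<in> Obj C. \<forall>x \<in> homset C (Cod C f) X. x \<cdot>\<^bsub>C\<^esub> f = Zero C (Dom C f) X \<longrightarrow>
        (\<exists>!h. h \<in> homset C (Cod C q) X \<and> h \<cdot>\<^bsub>C\<^esub> q = x))"

definition is_biproduct ::
    "('o, 'm) precat \<Rightarrow> 'o \<Rightarrow> 'o \<Rightarrow> 'o \<Rightarrow> 'm \<Rightarrow> 'm \<Rightarrow> 'm \<Rightarrow> 'm \<Rightarrow> bool" where
  "is_biproduct C X Y S i j p q \<longleftrightarrow>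
     i \<in> homset C X S \<and> j \<in> homset C Y S \<and> p \<in> homset C S X \<and> q \<in> homset C S Y \<and>
     p \<cdot>\<^bsub>C\<^esub> i = Id C X \<and> q \<cdot>\<^bsub>C\<^esub> j = Id C Y \<and>
     p \<cdot>\<^bsub>C\<^esub> j = Zero C Y X \<and> q \<cdot>\<^bsub>C\<^esub> i = Zero C X Y \<and>
     Add C (i \<cdot>\<^bsub>C\<^esub> p) (j \<cdot>\<^bsub>C\<^esub> q) = Id C S"

locale precategory =
  fixes C :: "('o, 'm) precat" (structure)
  assumes dom_obj: "f \<in> Arr C \<Longrightarrow> Dom C f \<in> Obj C"
    and cod_obj: "f \<in> Arr C \<Longrightarrow> Cod C f \<in> Obj C"
    and id_hom: "X \<in> Obj C \<Longrightarrow> Id C X \<in> homset C X X"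
    and comp_hom: "\<lbrakk>f \<in> homset C X Y; g \<in> homset C Y Z\<rbrakk> \<Longrightarrow> g \<cdot> f \<in> homset C X Z"
    and comp_id: "f \<in> homset C X Y \<Longrightarrow> f \<cdot> Id C X = f"
    and id_comp: "f \<in> homset C X Y \<Longrightarrow> Id C Y \<cdot> f = f"
    and comp_assoc: "\<lbrakk>f \<in> homset C W X; g \<in> homset C X Y; h \<in> homset C Y Z\<rbrakk>
      \<Longrightarrow> (h \<cdot> g) \<cdot> f = h \<cdot> (g \<cdot> f)"

locale preadditive_category = precategory +
  assumes hom_comm_group: "\<lbrakk>X \<in> Obj C; Y \<in> Obj C\<rbrakk> \<Longrightarrow> comm_group (hom_group C X Y)"
    and comp_add: "\<lbrakk>f \<in> homset C X Y; f' \<in> homset C X Y; g \<in> homset C Y Z\<rbrakk>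
      \<Longrightarrow> g \<cdot> Add C f f' = Add C (g \<cdot> f) (g \<cdot> f')"
    and add_comp: "\<lbrakk>f \<in> homset C X Y; g \<in> homset C Y Z; g' \<in> homset C Y Z\<rbrakk>
      \<Longrightarrow> Add C g g' \<cdot> f = Add C (g \<cdot> f) (g' \<cdot> f)"

locale abelian_category = preadditive_category +
  assumes ex_zero_object: "\<exists>Z. zero_object C Z"
    and ex_biproduct: "\<lbrakk>X \<in> Obj C; Y \<in> Obj C\<rbrakk> \<Longrightarrow> \<exists>S i j p q. is_biproduct C X Y S i j p q"
    and ex_kernel: "f \<in> Arr C \<Longrightarrow> \<exists>m. is_kernel C f m"
    and ex_cokernel: "f \<in> Arr C \<Longrightarrow> \<exists>q. is_cokernel C f q"
    and monic_is_kernel: "monic C m \<Longrightarrow> \<exists>f. is_kernel C f m"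
    and epic_is_cokernel: "epic C q \<Longrightarrow> \<exists>f. is_cokernel C f q"

text \<open>The image of \<open>f\<close> is the kernel of the cokernel of \<open>f\<close>.\<close>

definition is_image :: "('o, 'm) precat \<Rightarrow> 'm \<Rightarrow> 'm \<Rightarrow> bool" where
  "is_image C f m \<longleftrightarrow> (\<exists>q. is_cokernel C f q \<and> is_kernel C q m)"

definition exact :: "('o, 'm) precat \<Rightarrow> 'm \<Rightarrow> 'm \<Rightarrow> bool" where
  "exact C f g \<longleftrightarrow> (\<exists>m. is_image C f m \<and> is_kernel C g m)"

definition short_exact :: "('o, 'm) precat \<Rightarrow> 'o \<Rightarrow> 'm \<Rightarrow> 'o \<Rightarrow> 'm \<Rightarrow> 'o \<Rightarrow> bool" where
  "short_exact C K f X g Y \<longleftrightarrow> f \<in> homset C K X \<and> g \<in> homset C X Y \<and>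
     (\<exists>Z. zero_object C Z \<and>
        exact C (Zero C Z K) f \<and> exact C f g \<and> exact C g (Zero C Y Z))"

definition direct_summand :: "('o, 'm) precat \<Rightarrow> 'o \<Rightarrow> 'o \<Rightarrow> bool" where
  "direct_summand C X S \<longleftrightarrow>
     X \<in> Obj C \<and> S \<in> Obj C \<and> (\<exists>Y \<in> Obj C. \<exists>i j p q. is_biproduct C X Y S i j p q)"


section \<open>Projectives and Ext\<close>

definition projective :: "('o, 'm) precat \<Rightarrow> 'o \<Rightarrow> bool" where
  "projective C P \<longleftrightarrow> P \<in> Obj C \<and>
     (\<forall>e f. epic C e \<and> f \<in> homset C P (Cod C e) \<longrightarrow>
        (\<exists>h \<in> homset C P (Dom C e). e \<cdot>\<^bsub>C\<^esub> h = f))"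

definition enough_projectives :: "('o, 'm) precat \<Rightarrow> bool" where
  "enough_projectives C \<longleftrightarrow>
     (\<forall>X \<in> Obj C. \<exists>P e. projective C P \<and> e \<in> homset C P X \<and> epic C e)"

text \<open>A projective resolution \<open>\<cdots> \<rightarrow> P 1 \<rightarrow> P 0 \<rightarrow> X \<rightarrow> 0\<close>. The map \<open>d 0\<close> is the augmentation
  \<open>P 0 \<rightarrow> X\<close>, and \<open>d i : P i \<rightarrow> P (i - 1)\<close> for \<open>i \<ge> 1\<close>.\<close>

definition projective_resolution ::
    "('o, 'm) precat \<Rightarrow> 'o \<Rightarrow> (nat \<Rightarrow> 'o) \<Rightarrow> (nat \<Rightarrow> 'm) \<Rightarrow> bool" where
  "projective_resolution C X P d \<longleftrightarrow>
     (\<forall>i. projective C (P i)) \<and>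
     d 0 \<in> homset C (P 0) X \<and> (\<forall>i. d (Suc i) \<in> homset C (P (Suc i)) (P i)) \<and>
     (\<exists>Z. zero_object C Z \<and> exact C (d 0) (Zero C X Z)) \<and>
     (\<forall>i. exact C (d (Suc i)) (d i))"

definition cocycles ::
    "('o, 'm) precat \<Rightarrow> (nat \<Rightarrow> 'o) \<Rightarrow> (nat \<Rightarrow> 'm) \<Rightarrow> 'o \<Rightarrow> nat \<Rightarrow> 'm set" where
  "cocycles C P d Y i = {f \<in> homset C (P i) Y. f \<cdot>\<^bsub>C\<^esub> d (Suc i) = Zero C (P (Suc i)) Y}"

text \<open>The augmentation \<open>d 0\<close> is not part of the complex \<open>Hom(P, Y)\<close>.\<close>

fun coboundaries ::
    "('o, 'm) precat \<Rightarrow> (nat \<Rightarrow> 'o) \<Rightarrow> (nat \<Rightarrow> 'm) \<Rightarrow> 'o \<Rightarrow> nat \<Rightarrow> 'm set" where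
  "coboundaries C P d Y 0 = {Zero C (P 0) Y}"
| "coboundaries C P d Y (Suc i) = (\<lambda>g. g \<cdot>\<^bsub>C\<^esub> d (Suc i)) ` homset C (P i) Y"

definition cohomology ::
    "('o, 'm) precat \<Rightarrow> (nat \<Rightarrow> 'o) \<Rightarrow> (nat \<Rightarrow> 'm) \<Rightarrow> 'o \<Rightarrow> nat \<Rightarrow> 'm set monoid" where
  "cohomology C P d Y i =
     ((hom_group C (P i) Y)\<lparr>carrier := cocycles C P d Y i\<rparr>) Mod (coboundaries C P d Y i)"

text \<open>In the presence of enough projectives, \<open>Ext\<^sup>i(X, Y)\<close> is the \<open>i\<close>-th right derived functor of
  \<open>Hom(-, Y)\<close> at \<open>X\<close>, computed from a chosen projective resolution of \<open>X\<close>; up to isomorphism the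
  group does not depend on the choice.\<close>

definition Ext :: "('o, 'm) precat \<Rightarrow> nat \<Rightarrow> 'o \<Rightarrow> 'o \<Rightarrow> 'm set monoid" where
  "Ext C i X Y =
     (let (P, d) = (SOME (P, d). projective_resolution C X P d) in cohomology C P d Y i)"

definition Ext_vanishes :: "('o, 'm) precat \<Rightarrow> nat \<Rightarrow> 'o set \<Rightarrow> 'o set \<Rightarrow> bool" where
  "Ext_vanishes C i \<A> \<B> \<longleftrightarrow> (\<forall>X \<in> \<A>. \<forall>Y \<in> \<B>. trivial_group (Ext C i X Y))"

definition left_perp :: "('o, 'm) precat \<Rightarrow> nat \<Rightarrow> 'o set \<Rightarrow> 'o set" where
  "left_perp C i \<B> = {X \<in> Obj C. Ext_vanishes C i {X} \<B>}"


section \<open>Resolution dimension, left cotorsion pairs, precovers\<close>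

text \<open>There is an exact sequence \<open>0 \<rightarrow> X m \<rightarrow> \<cdots> \<rightarrow> X 0 \<rightarrow> Y \<rightarrow> 0\<close> with all \<open>X j\<close> in \<open>\<X>\<close>;
  indexing of the maps is as for projective resolutions.\<close>

definition has_resolution :: "('o, 'm) precat \<Rightarrow> 'o set \<Rightarrow> 'o \<Rightarrow> nat \<Rightarrow> bool" where
  "has_resolution C \<X> Y m \<longleftrightarrow>
     (\<exists>X d Z. (\<forall>j \<le> m. X j \<in> \<X>) \<and> zero_object C Z \<and>
        d 0 \<in> homset C (X 0) Y \<and> (\<forall>j < m. d (Suc j) \<in> homset C (X (Suc j)) (X j)) \<and>
        exact C (d 0) (Zero C Y Z) \<and>
        (\<forall>j < m. exact C (d (Suc j)) (d j)) \<and>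
        exact C (Zero C Z (X m)) (d m))"

text \<open>The infimum of the empty set in \<^typ>\<open>enat\<close> is \<open>\<infinity>\<close>.\<close>

definition resdim :: "('o, 'm) precat \<Rightarrow> 'o set \<Rightarrow> 'o \<Rightarrow> enat" where
  "resdim C \<X> Y = Inf (enat ` {m. has_resolution C \<X> Y m})"

definition resdim_le_class :: "('o, 'm) precat \<Rightarrow> 'o set \<Rightarrow> nat \<Rightarrow> 'o set" where
  "resdim_le_class C \<X> m = {Y \<in> Obj C. resdim C \<X> Y \<le> enat m}"

text \<open>The index \<open>n - 1\<close> is truncated subtraction; the notion is meant for \<open>n \<ge> 1\<close>.\<close>

definition left_cotorsion_pair ::
    "('o, 'm) precat \<Rightarrow> nat \<Rightarrow> 'o set \<Rightarrow> 'o set \<Rightarrow> bool" where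
  "left_cotorsion_pair C n \<A> \<B> \<longleftrightarrow> \<A> \<subseteq> Obj C \<and> \<B> \<subseteq> Obj C \<and>
     (\<forall>X \<in> \<A>. \<forall>Y. direct_summand C Y X \<longrightarrow> Y \<in> \<A>) \<and>
     (\<forall>i. 1 \<le> i \<and> i \<le> n \<longrightarrow> Ext_vanishes C i \<A> \<B>) \<and>
     (\<forall>Y \<in> Obj C. \<exists>K f X g. short_exact C K f X g Y \<and>
        X \<in> \<A> \<and> K \<in> resdim_le_class C \<B> (n - 1))"

definition precover :: "('o, 'm) precat \<Rightarrow> 'o set \<Rightarrow> 'o \<Rightarrow> 'm \<Rightarrow> bool" where
  "precover C \<X> Y f \<longleftrightarrow> f \<in> Arr C \<and> Dom C f \<in> \<X> \<and> Cod C f = Y \<and>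
     (\<forall>X' \<in> \<X>. \<forall>f' \<in> homset C X' Y. \<exists>h \<in> homset C X' (Dom C f). f' = f \<cdot>\<^bsub>C\<^esub> h)"

definition unique_mapping_property :: "('o, 'm) precat \<Rightarrow> 'o set \<Rightarrow> 'o \<Rightarrow> 'm \<Rightarrow> bool" where
  "unique_mapping_property C \<X> Y f \<longleftrightarrow>
     (\<forall>X' \<in> \<X>. \<forall>f' \<in> homset C X' Y. \<exists>!h. h \<in> homset C X' (Dom C f) \<and> f' = f \<cdot>\<^bsub>C\<^esub> h)"

end

theory Submission
  imports Defs
begin

text \<open>
  With enough projectives, exactness can be checked on morphisms out of projective objects, and
  \<open>Ext\<^sup>i\<^sup>+\<^sup>1(X, Y)\<close> vanishes iff every map to \<open>Y\<close> from an \<open>(i+1)\<close>-st syzygy of \<open>X\<close> extends to the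
  projective containing it.

  If \<open>f : D \<rightarrow> X\<close> is a precover with unique lifts by a class containing the projectives, then \<open>f\<close> is
  epic because projective covers of \<open>X\<close> lift, and monic because two lifts of the same map from a
  projective agree; so \<open>X \<cong> D\<close>. If every object is left orthogonal
  to \<open>\<B>\<close> in degree \<open>k + 1\<close>, then by dimension shifting the \<open>k\<close>-th syzygies lie in \<open>\<A>\<close>, as do the
  projectives, which gives \<open>\<A>\<close>-resolutions of length \<open>k\<close>. Conversely, the vanishing of Ext in degrees
  up to \<open>k + 1 \<le> n\<close> on \<open>\<A>\<close> propagates along such a resolution.
\<close>

section \<open>Arithmetic of morphisms\<close>

text \<open>\<open>Ext\<close> is computed from a resolution picked by \<open>SOME\<close>, so its
  vanishing must first be freed from that choice. Instead of comparing resolutions up to homotopy,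
  the proof uses a recursive predicate \<open>ext_vanish\<close>, which ranges over all syzygies,
  and \<open>stable_retract\<close>, retraction up to maps through a projective. Stable retraction
  passes to syzygies and carries \<open>ext_vanish\<close> along, so any single presentation decides
  \<open>ext_vanish\<close>; this covers invariance under isomorphism as well as independence of the
  projective covers. The bridge to the groups \<open>Ext\<close> is \<open>trivial_Ext_iff\<close>.
  Connecting morphisms are avoided in the same spirit: a short exact sequence is rotated into one
  whose first two terms are syzygies of its last two terms, and this yields the fragments of the
  long exact sequence that dimension shifting needs. Condition (c) gives (a) through identities:
  once the class contains every object, the identity of each object is a precover with unique
  lifts.\<close>

context precategory
begin

lemma homset_objs: "f \<in> homset C X Y \<Longrightarrow> X \<in> Obj C \<and> Y \<in> Obj C"
  using dom_obj cod_obj unfolding homset_def by auto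

lemma comp_arr:
  assumes "f \<in> Arr C" "g \<in> Arr C" "Cod C f = Dom C g"
  shows "g \<cdot> f \<in> Arr C" "Dom C (g \<cdot> f) = Dom C f" "Cod C (g \<cdot> f) = Cod C g"
  using comp_hom[of f "Dom C f" "Cod C f" g "Cod C g"] assms by (auto simp: homset_def)

lemma id_arr:
  assumes "X \<in> Obj C"
  shows "Id C X \<in> Arr C" "Dom C (Id C X) = X" "Cod C (Id C X) = X"
  using id_hom[OF assms] by (auto simp: homset_def)

lemma comp_id_arr: "f \<in> Arr C \<Longrightarrow> Dom C f = X \<Longrightarrow> f \<cdot> Id C X = f"
  using comp_id by (auto simp: homset_def)

lemma id_comp_arr: "f \<in> Arr C \<Longrightarrow> Cod C f = X \<Longrightarrow> Id C X \<cdot> f = f"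
  using id_comp by (auto simp: homset_def)

lemma assoc_arr:
  "\<lbrakk>f \<in> Arr C; g \<in> Arr C; h \<in> Arr C; Cod C f = Dom C g; Cod C g = Dom C h\<rbrakk>
    \<Longrightarrow> (h \<cdot> g) \<cdot> f = h \<cdot> (g \<cdot> f)"
  using comp_assoc[of f "Dom C f" "Cod C f" g "Cod C g" h "Cod C h"] by (auto simp: homset_def)

text \<open>Rewriting with \<open>assoc_arr\<close> brackets composites to the right, where
  \<open>g \<cdot> f\<close> no longer occurs as a subterm; this is the form of the equation that
  still applies.\<close>

lemma comp_ext:
  "\<lbrakk>g \<cdot> f = k; f \<in> Arr C; g \<in> Arr C; Cod C f = Dom C g; x \<in> Arr C; Cod C x = Dom C f\<rbrakk>
    \<Longrightarrow> g \<cdot> (f \<cdot> x) = k \<cdot> x"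
  using assoc_arr by metis

lemmas cat_simps = homset_def comp_arr id_arr comp_id_arr id_comp_arr assoc_arr dom_obj cod_obj

end

section \<open>Additive calculus in the hom groups; monics, epics and kernels\<close>

context preadditive_category
begin

abbreviation add (infixl "\<boxplus>" 65) where "f \<boxplus> g \<equiv> Add C f g"

definition neg where "neg f = m_inv (hom_group C (Dom C f) (Cod C f)) f"

lemma hom_group_simps [simp]:
  "carrier (hom_group C X Y) = homset C X Y"
  "monoid.mult (hom_group C X Y) = Add C"
  "one (hom_group C X Y) = Zero C X Y"
  by (simp_all add: hom_group_def)

lemma hom_group_arr: "f \<in> Arr C \<Longrightarrow> comm_group (hom_group C (Dom C f) (Cod C f))"
  using hom_comm_group dom_obj cod_obj by blast

lemma zero_arr:
  assumes "X \<in> Obj C" "Y \<in> Obj C"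
  shows "Zero C X Y \<in> Arr C" "Dom C (Zero C X Y) = X" "Cod C (Zero C X Y) = Y"
proof -
  interpret comm_group "hom_group C X Y" using assms by (rule hom_comm_group)
  show "Zero C X Y \<in> Arr C" "Dom C (Zero C X Y) = X" "Cod C (Zero C X Y) = Y"
    using one_closed by (auto simp: homset_def)
qed

lemma add_arr:
  assumes "f \<in> Arr C" "g \<in> Arr C" "Dom C g = Dom C f" "Cod C g = Cod C f"
  shows "f \<boxplus> g \<in> Arr C" "Dom C (f \<boxplus> g) = Dom C f" "Cod C (f \<boxplus> g) = Cod C f"
proof -
  interpret comm_group "hom_group C (Dom C f) (Cod C f)" using assms by (simp add: hom_group_arr)
  show "f \<boxplus> g \<in> Arr C" "Dom C (f \<boxplus> g) = Dom C f" "Cod C (f \<boxplus> g) = Cod C f"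
    using m_closed[of f g] assms by (auto simp: homset_def)
qed

lemma neg_arr:
  assumes "f \<in> Arr C"
  shows "neg f \<in> Arr C" "Dom C (neg f) = Dom C f" "Cod C (neg f) = Cod C f"
proof -
  interpret comm_group "hom_group C (Dom C f) (Cod C f)" using assms by (rule hom_group_arr)
  show "neg f \<in> Arr C" "Dom C (neg f) = Dom C f" "Cod C (neg f) = Cod C f"
    using inv_closed[of f] assms by (auto simp: homset_def neg_def)
qed

lemma add_neg:
  assumes "f \<in> Arr C"
  shows "f \<boxplus> neg f = Zero C (Dom C f) (Cod C f)"
proof -
  interpret comm_group "hom_group C (Dom C f) (Cod C f)" using assms by (rule hom_group_arr)
  show ?thesis using r_inv[of f] assms by (auto simp: homset_def neg_def)
qed

lemma add_zero:
  assumes "f \<in> Arr C" "Dom C f = X" "Cod C f = Y"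
  shows "f \<boxplus> Zero C X Y = f" "Zero C X Y \<boxplus> f = f"
proof -
  interpret comm_group "hom_group C X Y" using assms hom_group_arr by blast
  show "f \<boxplus> Zero C X Y = f" "Zero C X Y \<boxplus> f = f"
    using r_one[of f] l_one[of f] assms by (auto simp: homset_def)
qed

lemma add_assoc:
  assumes "f \<in> Arr C" "g \<in> Arr C" "h \<in> Arr C" "Dom C g = Dom C f" "Cod C g = Cod C f"
    "Dom C h = Dom C f" "Cod C h = Cod C f"
  shows "(f \<boxplus> g) \<boxplus> h = f \<boxplus> (g \<boxplus> h)"
proof -
  interpret comm_group "hom_group C (Dom C f) (Cod C f)" using assms by (simp add: hom_group_arr)
  show ?thesis using m_assoc[of f g h] assms by (auto simp: homset_def)
qed

lemma add_left_cancel: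
  assumes "f \<in> Arr C" "g \<in> Arr C" "h \<in> Arr C" "Dom C g = Dom C f" "Cod C g = Cod C f"
    "Dom C h = Dom C f" "Cod C h = Cod C f" "f \<boxplus> g = f \<boxplus> h"
  shows "g = h"
proof -
  interpret comm_group "hom_group C (Dom C f) (Cod C f)" using assms by (simp add: hom_group_arr)
  show ?thesis using Units_l_cancel[of f g h] assms by (auto simp: homset_def)
qed

lemma add_left_cancel_hom:
  "\<lbrakk>f \<in> homset C X Y; g \<in> homset C X Y; h \<in> homset C X Y; f \<boxplus> g = f \<boxplus> h\<rbrakk> \<Longrightarrow> g = h"
  using add_left_cancel[of f g h] by (simp add: homset_def)

lemma comp_add_arr:
  assumes "f \<in> Arr C" "f' \<in> Arr C" "g \<in> Arr C" "Dom C f' = Dom C f" "Cod C f' = Cod C f"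
    "Cod C f = Dom C g"
  shows "g \<cdot> (f \<boxplus> f') = g \<cdot> f \<boxplus> g \<cdot> f'"
  using comp_add[of f "Dom C f" "Cod C f" f' g "Cod C g"] assms by (simp add: homset_def)

lemma add_comp_arr:
  assumes "f \<in> Arr C" "g \<in> Arr C" "g' \<in> Arr C" "Dom C g' = Dom C g" "Cod C g' = Cod C g"
    "Cod C f = Dom C g"
  shows "(g \<boxplus> g') \<cdot> f = g \<cdot> f \<boxplus> g' \<cdot> f"
  using add_comp[of f "Dom C f" "Cod C f" g "Cod C g" g'] assms by (simp add: homset_def)

lemma comp_zero:
  assumes "g \<in> Arr C" "X \<in> Obj C" "Dom C g = Y" "Cod C g = Z"
  shows "g \<cdot> Zero C X Y = Zero C X Z"
proof -
  have Y: "Y \<in> Obj C" "Z \<in> Obj C" using assms dom_obj cod_obj by auto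
  let ?z = "Zero C X Y"
  have "g \<cdot> ?z \<boxplus> g \<cdot> ?z = g \<cdot> ?z \<boxplus> Zero C X Z"
    using assms Y comp_add_arr[of ?z ?z g]
    by (simp add: zero_arr add_zero comp_arr)
  then show ?thesis using add_left_cancel[of "g \<cdot> ?z" "g \<cdot> ?z" "Zero C X Z"] assms Y
    by (simp add: zero_arr comp_arr)
qed

lemma zero_comp:
  assumes "f \<in> Arr C" "Z \<in> Obj C" "Dom C f = X" "Cod C f = Y"
  shows "Zero C Y Z \<cdot> f = Zero C X Z"
proof -
  have Y: "Y \<in> Obj C" "X \<in> Obj C" using assms dom_obj cod_obj by auto
  let ?z = "Zero C Y Z"
  have "?z \<cdot> f \<boxplus> ?z \<cdot> f = ?z \<cdot> f \<boxplus> Zero C X Z"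
    using assms Y add_comp_arr[of f ?z ?z]
    by (simp add: zero_arr add_zero comp_arr)
  then show ?thesis using add_left_cancel[of "?z \<cdot> f" "?z \<cdot> f" "Zero C X Z"] assms Y
    by (simp add: zero_arr comp_arr)
qed

lemmas additive_simps = cat_simps zero_arr add_arr neg_arr add_zero comp_zero zero_comp
  comp_add_arr add_comp_arr

text \<open>The difference of \<open>f\<close> and \<open>g\<close> in the form in which it is used
  later: as a summand that is cancelled, factored or shown to vanish.\<close>

lemma difference:
  assumes "f \<in> homset C X Y" "g \<in> homset C X Y"
  obtains d where "d \<in> homset C X Y" "f = g \<boxplus> d"
proof
  show "neg g \<boxplus> f \<in> homset C X Y" using assms by (simp add: additive_simps)
  have "g \<boxplus> (neg g \<boxplus> f) = (g \<boxplus> neg g) \<boxplus> f"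
    using assms by (simp add: additive_simps add_assoc)
  also have "\<dots> = f" using assms by (auto simp: additive_simps add_neg)
  finally show "f = g \<boxplus> (neg g \<boxplus> f)" by simp
qed

lemma neg_comp:
  assumes "f \<in> Arr C" "g \<in> Arr C" "Cod C f = Dom C g"
  shows "neg g \<cdot> f = neg (g \<cdot> f)"
proof -
  have "g \<cdot> f \<boxplus> neg g \<cdot> f = g \<cdot> f \<boxplus> neg (g \<cdot> f)"
    using assms add_comp_arr[of f g "neg g"] by (simp add: additive_simps add_neg)
  then show ?thesis using add_left_cancel[of "g \<cdot> f" "neg g \<cdot> f" "neg (g \<cdot> f)"] assms
    by (simp add: additive_simps)
qed

lemma zero_hom: "X \<in> Obj C \<Longrightarrow> Y \<in> Obj C \<Longrightarrow> Zero C X Y \<in> homset C X Y"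
  by (simp add: additive_simps)

lemma add_hom: "f \<in> homset C X Y \<Longrightarrow> g \<in> homset C X Y \<Longrightarrow> f \<boxplus> g \<in> homset C X Y"
  by (simp add: additive_simps)

text \<open>By additivity, if \<open>f\<close> equalizes two morphisms then it annihilates their
  difference, so only the zero case has to be tested.\<close>

lemma monic_homI:
  assumes "f \<in> homset C X Y"
    "\<And>T x. x \<in> homset C T X \<Longrightarrow> f \<cdot> x = Zero C T Y \<Longrightarrow> x = Zero C T X"
  shows "monic C f"
  unfolding monic_def
proof (intro conjI ballI impI)
  show "f \<in> Arr C" using assms(1) by (simp add: homset_def)
  fix T g h
  assume g: "T \<in> Obj C" "g \<in> homset C T (Dom C f)" "h \<in> homset C T (Dom C f)" "f \<cdot> g = f \<cdot> h"
  then have g': "g \<in> homset C T X" "h \<in> homset C T X" using assms(1) by (auto simp: homset_def)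
  obtain d where d: "d \<in> homset C T X" "g = h \<boxplus> d" using difference[OF g'] .
  have "f \<cdot> h \<boxplus> f \<cdot> d = f \<cdot> h \<boxplus> Zero C T Y"
    using d g g' assms(1) comp_add_arr[of h d f] by (auto simp: additive_simps)
  then have "f \<cdot> d = Zero C T Y"
    using add_left_cancel[of "f \<cdot> h" "f \<cdot> d" "Zero C T Y"] d g g' assms(1)
    by (auto simp: additive_simps)
  then show "g = h" using assms(2)[OF d(1)] d(2) g' by (auto simp: additive_simps)
qed

lemma epic_homI:
  assumes "f \<in> homset C X Y"
    "\<And>T x. x \<in> homset C Y T \<Longrightarrow> x \<cdot> f = Zero C X T \<Longrightarrow> x = Zero C Y T"
  shows "epic C f"
  unfolding epic_def
proof (intro conjI ballI impI)
  show "f \<in> Arr C" using assms(1) by (simp add: homset_def)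
  fix T g h
  assume g: "T \<in> Obj C" "g \<in> homset C (Cod C f) T" "h \<in> homset C (Cod C f) T" "g \<cdot> f = h \<cdot> f"
  then have g': "g \<in> homset C Y T" "h \<in> homset C Y T" using assms(1) by (auto simp: homset_def)
  obtain d where d: "d \<in> homset C Y T" "g = h \<boxplus> d" using difference[OF g'] .
  have "h \<cdot> f \<boxplus> d \<cdot> f = h \<cdot> f \<boxplus> Zero C X T"
    using d g g' assms(1) add_comp_arr[of f h d] by (auto simp: additive_simps)
  then have "d \<cdot> f = Zero C X T"
    using add_left_cancel[of "h \<cdot> f" "d \<cdot> f" "Zero C X T"] d g g' assms(1)
    by (auto simp: additive_simps)
  then show "g = h" using assms(2)[OF d(1)] d(2) g' by (auto simp: additive_simps)
qed

lemma monicD: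
  "\<lbrakk>monic C f; g \<in> homset C T X; h \<in> homset C T X; f \<in> homset C X Y; f \<cdot> g = f \<cdot> h\<rbrakk> \<Longrightarrow> g = h"
  using homset_objs unfolding monic_def by (auto simp: homset_def)

lemma epicD:
  "\<lbrakk>epic C f; g \<in> homset C Y T; h \<in> homset C Y T; f \<in> homset C X Y; g \<cdot> f = h \<cdot> f\<rbrakk> \<Longrightarrow> g = h"
  using homset_objs unfolding epic_def by (auto simp: homset_def)

lemma is_kernelD:
  assumes "is_kernel C f m" "f \<in> homset C X Y"
  shows "m \<in> homset C (Dom C m) X" "f \<cdot> m = Zero C (Dom C m) Y" "monic C m"
proof -
  show m: "m \<in> homset C (Dom C m) X" "f \<cdot> m = Zero C (Dom C m) Y"
    using assms by (auto simp: is_kernel_def homset_def)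
  show "monic C m"
    unfolding monic_def
  proof (intro conjI ballI impI)
    show "m \<in> Arr C" using m by (simp add: homset_def)
    fix T g h
    assume g: "T \<in> Obj C" "g \<in> homset C T (Dom C m)" "h \<in> homset C T (Dom C m)" "m \<cdot> g = m \<cdot> h"
    have "f \<cdot> (m \<cdot> g) = Zero C (Dom C m) Y \<cdot> g"
      using comp_ext[OF m(2), of g] m g assms(2) by (simp add: homset_def)
    also have "\<dots> = Zero C T Y" using m g assms by (auto simp: additive_simps)
    finally have "f \<cdot> (m \<cdot> g) = Zero C T (Cod C f)" using assms by (auto simp: homset_def)
    moreover have "m \<cdot> g \<in> homset C T (Dom C f)" using m g assms by (auto simp: additive_simps)
    \<comment> \<open>The uniqueness half of the universal property, for the morphism
      \<open>m \<cdot> g\<close>, of which both \<open>g\<close> and \<open>h\<close> are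
      lifts.\<close>
    ultimately have "\<exists>!k. k \<in> homset C T (Dom C m) \<and> m \<cdot> k = m \<cdot> g"
      using assms(1) g(1) by (auto simp: is_kernel_def)
    with g show "g = h" by metis
  qed
qed

lemma kernel_lift:
  assumes "is_kernel C f m" "f \<in> homset C X Y" "x \<in> homset C T X" "f \<cdot> x = Zero C T Y"
  obtains y where "y \<in> homset C T (Dom C m)" "m \<cdot> y = x"
proof -
  have "\<forall>x \<in> homset C T (Dom C f). f \<cdot> x = Zero C T (Cod C f) \<longrightarrow>
      (\<exists>!h. h \<in> homset C T (Dom C m) \<and> m \<cdot> h = x)"
    using assms(1) homset_objs[OF assms(3)] unfolding is_kernel_def by blast
  moreover have "x \<in> homset C T (Dom C f)" "f \<cdot> x = Zero C T (Cod C f)"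
    using assms by (auto simp: homset_def)
  ultimately show ?thesis using that by blast
qed

lemma is_kernelI:
  assumes "f \<in> homset C X Y" "m \<in> homset C K X" "f \<cdot> m = Zero C K Y" "monic C m"
    "\<And>T x. x \<in> homset C T X \<Longrightarrow> f \<cdot> x = Zero C T Y \<Longrightarrow> \<exists>y \<in> homset C T K. m \<cdot> y = x"
  shows "is_kernel C f m"
  unfolding is_kernel_def
proof (intro conjI ballI impI)
  show "f \<in> Arr C" "m \<in> Arr C" "Cod C m = Dom C f" "f \<cdot> m = Zero C (Dom C m) (Cod C f)"
    using assms by (auto simp: homset_def)
  fix T x
  assume x: "T \<in> Obj C" "x \<in> homset C T (Dom C f)" "f \<cdot> x = Zero C T (Cod C f)"
  then have "\<exists>y \<in> homset C T K. m \<cdot> y = x" using assms(1,5) by (auto simp: homset_def)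
  then obtain y where y: "y \<in> homset C T K" "m \<cdot> y = x" by blast
  have "z = y" if "z \<in> homset C T K" "m \<cdot> z = x" for z
    using monicD[OF assms(4) that(1) y(1) assms(2)] that y by simp
  moreover have "Dom C m = K" using assms(2) by (simp add: homset_def)
  ultimately show "\<exists>!h. h \<in> homset C T (Dom C m) \<and> m \<cdot> h = x" using y by auto
qed

lemma epic_comp:
  assumes "epic C f" "epic C g" "f \<in> homset C X Y" "g \<in> homset C Y Z"
  shows "epic C (g \<cdot> f)"
proof (rule epic_homI)
  show "g \<cdot> f \<in> homset C X Z" using assms by (simp add: additive_simps)
  fix T x assume x: "x \<in> homset C Z T" "x \<cdot> (g \<cdot> f) = Zero C X T"
  have "(x \<cdot> g) \<cdot> f = Zero C Y T \<cdot> f" using x assms by (auto simp: additive_simps)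
  then have "x \<cdot> g = Zero C Y T"
    using epicD[OF assms(1) _ _ assms(3), of "x \<cdot> g" T "Zero C Y T"] x assms by (auto simp: additive_simps)
  then have "x \<cdot> g = Zero C Z T \<cdot> g" using x assms by (auto simp: additive_simps)
  then show "x = Zero C Z T"
    using epicD[OF assms(2) _ _ assms(4), of x T "Zero C Z T"] x assms by (auto simp: additive_simps)
qed

lemma id_epic: "X \<in> Obj C \<Longrightarrow> epic C (Id C X)"
  by (auto simp: epic_def additive_simps)

lemma id_monic: "X \<in> Obj C \<Longrightarrow> monic C (Id C X)"
  by (auto simp: monic_def additive_simps)

end

section \<open>Exactness tested on projective objects\<close>

locale abelian_enough_projectives = abelian_category +
  assumes enough_projectives: "enough_projectives C"
begin

lemma projective_cover:
  assumes "X \<in> Obj C"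
  obtains P e where "projective C P" "e \<in> homset C P X" "epic C e"
  using enough_projectives assms unfolding enough_projectives_def by blast

lemma projective_lift:
  assumes "projective C T" "epic C e" "e \<in> homset C X Y" "x \<in> homset C T Y"
  obtains y where "y \<in> homset C T X" "e \<cdot> y = x"
proof -
  have "\<exists>h \<in> homset C T (Dom C e). e \<cdot> h = x"
    using assms unfolding projective_def homset_def by blast
  then show ?thesis using that assms(3) unfolding homset_def by blast
qed

text \<open>A projective cover is epic, so morphisms out of projectives separate parallel arrows.
  They serve as generalized elements in the diagram chases below.\<close>

lemma eq_on_projectives:
  assumes "g \<in> homset C X Y" "h \<in> homset C X Y"
    "\<And>T x. projective C T \<Longrightarrow> x \<in> homset C T X \<Longrightarrow> g \<cdot> x = h \<cdot> x"
  shows "g = h"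
proof -
  obtain P e where e: "projective C P" "e \<in> homset C P X" "epic C e"
    using projective_cover homset_objs[OF assms(1)] by blast
  show ?thesis using epicD[OF e(3) assms(1,2) e(2)] assms(3) e by blast
qed

lemma epicI_projective:
  assumes "f \<in> homset C X Y"
    "\<And>T x. projective C T \<Longrightarrow> x \<in> homset C T Y \<Longrightarrow> \<exists>y \<in> homset C T X. f \<cdot> y = x"
  shows "epic C f"
proof (rule epic_homI[OF assms(1)])
  fix W x assume x: "x \<in> homset C Y W" "x \<cdot> f = Zero C X W"
  then have W: "W \<in> Obj C" "Y \<in> Obj C" using homset_objs by blast+
  show "x = Zero C Y W"
  proof (rule eq_on_projectives[OF x(1) zero_hom[OF W(2,1)]])
    fix T t assume t: "projective C T" "t \<in> homset C T Y"
    then obtain y where y: "y \<in> homset C T X" "f \<cdot> y = t" using assms(2) by blast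
    have "x \<cdot> t = Zero C X W \<cdot> y"
      using comp_ext[OF x(2), of y] y x assms(1) by (simp add: homset_def)
    then show "x \<cdot> t = Zero C Y W \<cdot> t" using x y t W by (auto simp: additive_simps)
  qed
qed

lemma monicI_projective:
  assumes "f \<in> homset C X Y"
    "\<And>T x. projective C T \<Longrightarrow> x \<in> homset C T X \<Longrightarrow> f \<cdot> x = Zero C T Y \<Longrightarrow> x = Zero C T X"
  shows "monic C f"
proof (rule monic_homI[OF assms(1)])
  fix W x assume x: "x \<in> homset C W X" "f \<cdot> x = Zero C W Y"
  then have W: "W \<in> Obj C" "X \<in> Obj C" "Y \<in> Obj C" using homset_objs assms(1) by blast+
  show "x = Zero C W X"
  proof (rule eq_on_projectives[OF x(1) zero_hom[OF W(1,2)]])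
    fix T t assume t: "projective C T" "t \<in> homset C T W"
    have "f \<cdot> (x \<cdot> t) = Zero C W Y \<cdot> t"
      using comp_ext[OF x(2), of t] t x assms(1) by (simp add: homset_def)
    then have "x \<cdot> t = Zero C T X"
      using assms(2)[OF t(1), of "x \<cdot> t"] x t W by (auto simp: additive_simps)
    then show "x \<cdot> t = Zero C W X \<cdot> t" using x t W by (auto simp: additive_simps)
  qed
qed

text \<open>\<open>e\<close> is the cokernel of some \<open>k\<close>. The hypothesis, applied to
  the elements \<open>k \<cdot> x\<close>, says that \<open>f\<close> annihilates \<open>k\<close>,
  and the universal property gives the factor.\<close>

lemma epic_factorization:
  assumes "epic C e" "e \<in> homset C X Y" "f \<in> homset C X W"
    "\<And>T x. projective C T \<Longrightarrow> x \<in> homset C T X \<Longrightarrow> e \<cdot> x = Zero C T Y \<Longrightarrow> f \<cdot> x = Zero C T W"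
  obtains g where "g \<in> homset C Y W" "g \<cdot> e = f"
proof -
  obtain k where k: "is_cokernel C k e" using epic_is_cokernel[OF assms(1)] by blast
  define K where "K = Dom C k"
  have k': "k \<in> homset C K X" "e \<cdot> k = Zero C K Y" and K: "K \<in> Obj C"
    using k assms(2) dom_obj by (auto simp: is_cokernel_def homset_def K_def)
  have W: "W \<in> Obj C" using assms(3) homset_objs by blast
  have "f \<cdot> k = Zero C K W"
  proof (rule eq_on_projectives)
    show "f \<cdot> k \<in> homset C K W" using k' assms by (auto simp: additive_simps)
    show "Zero C K W \<in> homset C K W" using K W by (rule zero_hom)
    fix T x assume x: "projective C T" "x \<in> homset C T K"
    have "e \<cdot> (k \<cdot> x) = Zero C K Y \<cdot> x"
      using comp_ext[OF k'(2), of x] x k' assms(2) by (simp add: homset_def)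
    then have "f \<cdot> (k \<cdot> x) = Zero C T W"
      using assms(4)[OF x(1), of "k \<cdot> x"] x k' assms(2) by (auto simp: additive_simps)
    then show "f \<cdot> k \<cdot> x = Zero C K W \<cdot> x" using x k' assms(3) W by (auto simp: additive_simps)
  qed
  then have "\<exists>!h. h \<in> homset C (Cod C e) W \<and> h \<cdot> e = f"
    using k W k' assms(2,3) unfolding is_cokernel_def homset_def by auto
  then show ?thesis using that assms(2) by (auto simp: homset_def)
qed

text \<open>The epic half of the image factorization. If \<open>u\<close> annihilates
  \<open>e\<close>, then \<open>f\<close> factors through \<open>m \<cdot> n\<close> for the kernel
  \<open>n\<close> of \<open>u\<close>. This monic is again a kernel, of some \<open>w\<close>; as
  \<open>w\<close> annihilates \<open>f\<close>, it factors through \<open>q\<close> and so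
  annihilates \<open>m\<close>. Hence \<open>m\<close> factors through \<open>m \<cdot> n\<close>,
  which makes \<open>n\<close> split epic and \<open>u\<close> zero.\<close>

lemma kernel_of_cokernel_factorization:
  assumes "is_cokernel C f q" "is_kernel C q m" "f \<in> homset C X Y"
  obtains e where "e \<in> homset C X (Dom C m)" "m \<cdot> e = f" "epic C e"
proof -
  define K Q where "K = Dom C m" and "Q = Cod C q"
  have q: "q \<in> homset C Y Q" "q \<cdot> f = Zero C X Q"
    using assms by (auto simp: is_cokernel_def homset_def Q_def)
  have m: "m \<in> homset C K Y" "q \<cdot> m = Zero C K Q" "monic C m"
    using is_kernelD[OF assms(2) q(1)] by (simp_all add: K_def)
  obtain e where e: "e \<in> homset C X K" "m \<cdot> e = f"
    using kernel_lift[OF assms(2) q(1) assms(3) q(2)] unfolding K_def by blast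
  have "epic C e"
  proof (rule epic_homI[OF e(1)])
    fix T u assume u: "u \<in> homset C K T" "u \<cdot> e = Zero C X T"
    have ob: "T \<in> Obj C" "K \<in> Obj C" "X \<in> Obj C" using u(1) e(1) homset_objs by auto
    obtain n where n0: "is_kernel C u n" using ex_kernel u by (auto simp: homset_def)
    define N where "N = Dom C n"
    have n: "n \<in> homset C N K" "u \<cdot> n = Zero C N T" "monic C n"
      using is_kernelD[OF n0 u(1)] by (simp_all add: N_def)
    obtain e' where e': "e' \<in> homset C X N" "n \<cdot> e' = e"
      using kernel_lift[OF n0 u(1) e(1) u(2)] unfolding N_def by blast
    have mn: "m \<cdot> n \<in> homset C N Y" using m n by (simp add: additive_simps)
    have N: "N \<in> Obj C" using n(1) homset_objs by blast
    have "monic C (m \<cdot> n)"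
    proof (rule monic_homI[OF mn])
      fix S x assume x: "x \<in> homset C S N" "m \<cdot> n \<cdot> x = Zero C S Y"
      have S: "S \<in> Obj C" using x homset_objs by blast
      have "m \<cdot> (n \<cdot> x) = m \<cdot> Zero C S K" using x m n S by (auto simp: additive_simps)
      then have "n \<cdot> x = Zero C S K"
        using monicD[OF m(3) _ _ m(1), of "n \<cdot> x" S "Zero C S K"] x n ob S zero_hom comp_hom by metis
      then have "n \<cdot> x = n \<cdot> Zero C S N" using n S by (auto simp: additive_simps)
      then show "x = Zero C S N" using monicD[OF n(3) x(1) _ n(1)] zero_hom[OF S N] by blast
    qed
    then obtain w where w0: "is_kernel C w (m \<cdot> n)" using monic_is_kernel by blast
    define W where "W = Cod C w"
    have w: "w \<in> homset C Y W" using w0 mn by (auto simp: is_kernel_def homset_def W_def)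
    have wmn: "w \<cdot> (m \<cdot> n) = Zero C N W" using is_kernelD[OF w0 w] mn by (auto simp: homset_def)
    have W: "W \<in> Obj C" using w homset_objs by blast
    have "f = (m \<cdot> n) \<cdot> e'" using e e' m n by (auto simp: additive_simps)
    then have "w \<cdot> f = Zero C N W \<cdot> e'" using comp_ext[OF wmn, of e'] w mn e' by (simp add: homset_def)
    then have wf: "w \<cdot> f = Zero C X W" using e' W by (auto simp: additive_simps)
    have "\<exists>!h. h \<in> homset C (Cod C q) W \<and> h \<cdot> q = w"
      using assms(1,3) w W wf unfolding is_cokernel_def by (auto simp: homset_def)
    then obtain w' where w': "w' \<in> homset C Q W" "w' \<cdot> q = w" unfolding Q_def by blast
    have "w \<cdot> m = w' \<cdot> (q \<cdot> m)" using w' q m by (auto simp: additive_simps)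
    also have "\<dots> = Zero C K W" using w' m(2) ob by (auto simp: additive_simps)
    finally obtain r where r: "r \<in> homset C K (Dom C (m \<cdot> n))" "m \<cdot> n \<cdot> r = m"
      using kernel_lift[OF w0 w m(1)] by blast
    then have r': "r \<in> homset C K N" using mn by (simp add: homset_def)
    have "m \<cdot> (n \<cdot> r) = m \<cdot> Id C K" using r r' m n by (auto simp: additive_simps)
    then have nr: "n \<cdot> r = Id C K"
      using monicD[OF m(3) comp_hom[OF r' n(1)] id_hom[OF ob(2)] m(1)] by blast
    have "u = u \<cdot> (n \<cdot> r)" using nr u by (auto simp: additive_simps)
    also have "\<dots> = Zero C N T \<cdot> r" using comp_ext[OF n(2), of r] r' n u by (simp add: homset_def)
    also have "\<dots> = Zero C K T" using r' ob by (auto simp: additive_simps)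
    finally show "u = Zero C K T" .
  qed
  then show ?thesis using that e unfolding K_def by blast
qed

lemma exact_kernel_factorization:
  assumes "exact C f g" "f \<in> homset C X Y" "g \<in> homset C Y W" "is_kernel C g m"
  obtains e where "e \<in> homset C X (Dom C m)" "m \<cdot> e = f" "epic C e"
proof -
  obtain m' q where m': "is_cokernel C f q" "is_kernel C q m'" "is_kernel C g m'"
    using assms(1) unfolding exact_def is_image_def by blast
  define K K' where "K = Dom C m" and "K' = Dom C m'"
  have k: "m \<in> homset C K Y" "g \<cdot> m = Zero C K W" "monic C m"
    using is_kernelD[OF assms(4,3)] by (simp_all add: K_def)
  have k': "m' \<in> homset C K' Y" "g \<cdot> m' = Zero C K' W" "monic C m'"
    using is_kernelD[OF m'(3) assms(3)] by (simp_all add: K'_def)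
  obtain e where e: "e \<in> homset C X (K')" "m' \<cdot> e = f" "epic C e"
    using kernel_of_cokernel_factorization[OF m'(1,2) assms(2)] unfolding K'_def .
  \<comment> \<open>Exactness offers only some kernel \<open>m'\<close> of \<open>g\<close>. The
    comparison \<open>r\<close> with the given kernel \<open>m\<close> is epic, so the factorization
    carries over.\<close>
  obtain r where r: "r \<in> homset C (K') (K)" "m \<cdot> r = m'"
    using kernel_lift[OF assms(4,3) k'(1,2)] unfolding K_def .
  have ob: "K \<in> Obj C" "K' \<in> Obj C" "X \<in> Obj C" using homset_objs k k' assms(2) by auto
  have mre: "m \<cdot> (r \<cdot> e) = f" using r e k(1) by (auto simp: additive_simps)
  have "epic C r"
  proof (rule epicI_projective[OF r(1)])
    fix T x assume x: "projective C T" "x \<in> homset C T (K)"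
    have T: "T \<in> Obj C" using x(2) homset_objs by blast
    have "g \<cdot> (m \<cdot> x) = Zero C (K) W \<cdot> x"
      using comp_ext[OF k(2), of x] x k assms(3) by (simp add: homset_def)
    also have "\<dots> = Zero C T W" using x assms(3) T by (auto simp: additive_simps)
    finally obtain y where y: "y \<in> homset C T (K')" "m' \<cdot> y = m \<cdot> x"
      using kernel_lift[OF m'(3) assms(3) comp_hom[OF x(2) k(1)]] unfolding K'_def by blast
    have "m \<cdot> (r \<cdot> y) = m \<cdot> x"
      using comp_ext[OF r(2), of y] y r k by (simp add: homset_def)
    then have "r \<cdot> y = x" using monicD[OF k(3) comp_hom[OF y(1) r(1)] x(2) k(1)] by blast
    then show "\<exists>y \<in> homset C T (K'). r \<cdot> y = x" using y by blast
  qed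
  then have "epic C (r \<cdot> e)" using epic_comp[OF e(3) _ e(1) r(1)] by blast
  then show ?thesis using that comp_hom[OF e(1) r(1)] mre unfolding K_def by blast
qed

lemma exact_comp_zero:
  assumes "exact C f g" "f \<in> homset C X Y" "g \<in> homset C Y W"
  shows "g \<cdot> f = Zero C X W"
proof -
  obtain m where m: "is_kernel C g m" using assms(1) unfolding exact_def by blast
  obtain e where e: "e \<in> homset C X (Dom C m)" "m \<cdot> e = f" "epic C e"
    using exact_kernel_factorization[OF assms m] .
  note k = is_kernelD[OF m assms(3)]
  have "g \<cdot> f = Zero C (Dom C m) W \<cdot> e"
    using comp_ext[OF k(2), of e] e k assms(3) by (simp add: homset_def)
  then show ?thesis using e assms by (auto simp: additive_simps)
qed

lemma exact_lift:
  assumes "exact C f g" "f \<in> homset C X Y" "g \<in> homset C Y W"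
    "projective C T" "x \<in> homset C T Y" "g \<cdot> x = Zero C T W"
  obtains y where "y \<in> homset C T X" "f \<cdot> y = x"
proof -
  obtain m where m: "is_kernel C g m" using assms(1) unfolding exact_def by blast
  obtain e where e: "e \<in> homset C X (Dom C m)" "m \<cdot> e = f" "epic C e"
    using exact_kernel_factorization[OF assms(1-3) m] .
  obtain z where z: "z \<in> homset C T (Dom C m)" "m \<cdot> z = x"
    using kernel_lift[OF m assms(3,5,6)] .
  obtain y where y: "y \<in> homset C T X" "e \<cdot> y = z"
    using projective_lift[OF assms(4) e(3,1) z(1)] .
  have "f \<cdot> y = x"
    using comp_ext[OF e(2), of y] y z e is_kernelD[OF m assms(3)] by (simp add: homset_def)
  with y show ?thesis using that by blast
qed

text \<open>The kernel \<open>m\<close> of \<open>g\<close> is also the kernel of the cokernel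
  \<open>q\<close> of \<open>f\<close>: the lifting hypothesis makes \<open>q\<close> annihilate
  \<open>m\<close>, and since \<open>g\<close> factors through \<open>q\<close>, whatever
  \<open>q\<close> annihilates is annihilated by \<open>g\<close>.\<close>

lemma exactI:
  assumes "f \<in> homset C X Y" "g \<in> homset C Y W" "g \<cdot> f = Zero C X W"
    "\<And>T x. projective C T \<Longrightarrow> x \<in> homset C T Y \<Longrightarrow> g \<cdot> x = Zero C T W
      \<Longrightarrow> \<exists>y \<in> homset C T X. f \<cdot> y = x"
  shows "exact C f g"
proof -
  obtain m where m: "is_kernel C g m" using ex_kernel assms(2) by (auto simp: homset_def)
  note k = is_kernelD[OF m assms(2)]
  define K where "K = Dom C m"
  have k1: "m \<in> homset C K Y" "g \<cdot> m = Zero C K W" using k K_def by simp_all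
  obtain e where e: "e \<in> homset C X K" "m \<cdot> e = f"
    using kernel_lift[OF m assms(2,1,3)] unfolding K_def by blast
  obtain q where q0: "is_cokernel C f q" using ex_cokernel assms(1) by (auto simp: homset_def)
  define Q where "Q = Cod C q"
  have q: "q \<in> homset C Y Q" "q \<cdot> f = Zero C X Q"
    using q0 assms(1) by (auto simp: is_cokernel_def homset_def Q_def)
  have ob: "W \<in> Obj C" "Q \<in> Obj C" "K \<in> Obj C" "X \<in> Obj C" using assms q k1 homset_objs by blast+
  have "\<exists>!h. h \<in> homset C (Cod C q) W \<and> h \<cdot> q = g"
    using q0 assms(1-3) ob unfolding is_cokernel_def by (auto simp: homset_def)
  then obtain g' where g': "g' \<in> homset C Q W" "g' \<cdot> q = g" unfolding Q_def by blast
  have "is_kernel C q m"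
  proof (rule is_kernelI[OF q(1) k1(1) _ k(3)])
    show "q \<cdot> m = Zero C K Q"
    proof (rule eq_on_projectives)
      show "q \<cdot> m \<in> homset C K Q" using k1 q comp_hom by blast
      show "Zero C K Q \<in> homset C K Q" using ob zero_hom by blast
      fix T x assume x: "projective C T" "x \<in> homset C T K"
      have "g \<cdot> (m \<cdot> x) = Zero C K W \<cdot> x"
        using comp_ext[OF k1(2), of x] x k1 assms(2) by (simp add: homset_def)
      also have "\<dots> = Zero C T W" using x ob by (auto simp: additive_simps)
      finally obtain y where y: "y \<in> homset C T X" "f \<cdot> y = m \<cdot> x"
        using assms(4)[OF x(1) comp_hom[OF x(2) k1(1)]] by blast
      have "q \<cdot> m \<cdot> x = q \<cdot> (f \<cdot> y)" using y(2) q x k1 by (auto simp: additive_simps)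
      also have "\<dots> = Zero C X Q \<cdot> y"
        using comp_ext[OF q(2), of y] y q assms(1) by (simp add: homset_def)
      finally show "q \<cdot> m \<cdot> x = Zero C K Q \<cdot> x" using x y ob by (auto simp: additive_simps)
    qed
    fix T x assume x: "x \<in> homset C T Y" "q \<cdot> x = Zero C T Q"
    have T: "T \<in> Obj C" using x homset_objs by blast
    have "g \<cdot> x = g' \<cdot> (q \<cdot> x)" using comp_ext[OF g'(2), of x] x q g' by (simp add: homset_def)
    also have "\<dots> = Zero C T W" using x(2) g' T by (auto simp: additive_simps)
    finally show "\<exists>y\<in>homset C T K. m \<cdot> y = x"
      using kernel_lift[OF m assms(2) x(1)] unfolding K_def by blast
  qed
  then show ?thesis using m q0 unfolding exact_def is_image_def by blast
qed

section \<open>Zero objects and exactness at the ends of a sequence\<close>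

lemma zero_object_obj: "zero_object C Z \<Longrightarrow> Z \<in> Obj C"
  by (simp add: zero_object_def)

lemma to_zero_object: "zero_object C Z \<Longrightarrow> f \<in> homset C X Z \<Longrightarrow> f = Zero C X Z"
  using homset_objs[of f X Z] zero_hom unfolding zero_object_def by blast

lemma from_zero_object: "zero_object C Z \<Longrightarrow> f \<in> homset C Z X \<Longrightarrow> f = Zero C Z X"
  using homset_objs[of f Z X] zero_hom unfolding zero_object_def by blast

text \<open>Every composite into a zero object vanishes, so the lifting form of exactness turns into
  the lifting form of being epic.\<close>

lemma exact_to_zero_iff:
  assumes "f \<in> homset C X Y" "zero_object C Z"
  shows "exact C f (Zero C Y Z) \<longleftrightarrow> epic C f"
proof -
  have ob: "X \<in> Obj C" "Y \<in> Obj C" "Z \<in> Obj C" using assms homset_objs zero_object_obj by blast+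
  have z: "Zero C Y Z \<in> homset C Y Z" using ob zero_hom by blast
  show ?thesis
  proof
    assume ex: "exact C f (Zero C Y Z)"
    show "epic C f"
    proof (rule epicI_projective[OF assms(1)])
      fix T x assume x: "projective C T" "x \<in> homset C T Y"
      have "Zero C Y Z \<cdot> x = Zero C T Z" using x ob by (auto simp: additive_simps)
      then show "\<exists>y\<in>homset C T X. f \<cdot> y = x" using exact_lift[OF ex assms(1) z x] by blast
    qed
  next
    assume ep: "epic C f"
    show "exact C f (Zero C Y Z)"
    proof (rule exactI[OF assms(1) z])
      show "Zero C Y Z \<cdot> f = Zero C X Z" using assms ob by (auto simp: additive_simps)
      fix T x assume x: "projective C T" "x \<in> homset C T Y"
      then show "\<exists>y\<in>homset C T X. f \<cdot> y = x" using projective_lift[OF x(1) ep assms(1) x(2)] by blast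
    qed
  qed
qed

lemma exact_from_zero_iff:
  assumes "f \<in> homset C X Y" "zero_object C Z"
  shows "exact C (Zero C Z X) f \<longleftrightarrow> monic C f"
proof -
  have ob: "X \<in> Obj C" "Y \<in> Obj C" "Z \<in> Obj C" using assms homset_objs zero_object_obj by blast+
  have z: "Zero C Z X \<in> homset C Z X" using ob zero_hom by blast
  show ?thesis
  proof
    assume ex: "exact C (Zero C Z X) f"
    show "monic C f"
    proof (rule monicI_projective[OF assms(1)])
      fix T x assume x: "projective C T" "x \<in> homset C T X" "f \<cdot> x = Zero C T Y"
      then obtain y where "y \<in> homset C T Z" "Zero C Z X \<cdot> y = x"
        using exact_lift[OF ex z assms(1) x] by blast
      then show "x = Zero C T X" using ob by (auto simp: additive_simps)
    qed
  next
    assume mo: "monic C f"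
    show "exact C (Zero C Z X) f"
    proof (rule exactI[OF z assms(1)])
      show "f \<cdot> Zero C Z X = Zero C Z Y" using assms ob by (auto simp: additive_simps)
      fix T x assume x: "projective C T" "x \<in> homset C T X" "f \<cdot> x = Zero C T Y"
      have T: "T \<in> Obj C" using x homset_objs by blast
      have "f \<cdot> x = f \<cdot> Zero C T X" using x T assms by (auto simp: additive_simps)
      then have "x = Zero C T X" using monicD[OF mo x(2) zero_hom[OF T ob(1)] assms(1)] by blast
      also have "\<dots> = Zero C Z X \<cdot> Zero C T Z" using T ob by (auto simp: additive_simps)
      finally show "\<exists>y\<in>homset C T Z. Zero C Z X \<cdot> y = x" using zero_hom[OF T ob(3)] by auto
    qed
  qed
qed

lemma monic_comp_zeroD:
  assumes "monic C f" "f \<in> homset C X Y" "x \<in> homset C T X" "f \<cdot> x = Zero C T Y"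
  shows "x = Zero C T X"
proof -
  have ob: "X \<in> Obj C" "T \<in> Obj C" using assms homset_objs by blast+
  have "f \<cdot> x = f \<cdot> Zero C T X" using assms ob by (auto simp: additive_simps)
  then show ?thesis using monicD[OF assms(1,3) zero_hom[OF ob(2,1)] assms(2)] by blast
qed

text \<open>\<open>f\<close> is the kernel of some \<open>g\<close>; being epic, it forces
  \<open>g\<close> to be zero, and then the identity of \<open>Y\<close> lifts along
  \<open>f\<close>. The right inverse exhibits \<open>Y\<close> as a retract of \<open>X\<close>,
  which is how the result is used.\<close>

lemma monic_epic_iso:
  assumes "monic C f" "epic C f" "f \<in> homset C X Y"
  obtains r where "r \<in> homset C Y X" "f \<cdot> r = Id C Y"
proof -
  obtain g where g0: "is_kernel C g f" using monic_is_kernel assms(1) by blast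
  define W where "W = Cod C g"
  have g: "g \<in> homset C Y W" using g0 assms(3) by (auto simp: is_kernel_def homset_def W_def)
  have ob: "X \<in> Obj C" "Y \<in> Obj C" "W \<in> Obj C" using assms(3) g homset_objs by blast+
  have "g \<cdot> f = Zero C Y W \<cdot> f" using is_kernelD[OF g0 g] assms(3) ob by (auto simp: additive_simps)
  then have "g = Zero C Y W" using epicD[OF assms(2) g zero_hom[OF ob(2,3)] assms(3)] by blast
  then have "g \<cdot> Id C Y = Zero C Y W" using g by (auto simp: additive_simps)
  then show ?thesis
    using kernel_lift[OF g0 g id_hom[OF ob(2)]] that assms(3) by (auto simp: homset_def)
qed

end

section \<open>Vanishing of Ext through syzygies\<close>

context abelian_enough_projectives
begin

text \<open>Encoded as an epic with its kernel instead of through \<open>short_exact\<close>: no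
  zero object or image has to be carried along, and lifts come directly from the kernel
  property.\<close>

definition ses :: "'a \<Rightarrow> 'b \<Rightarrow> 'a \<Rightarrow> 'b \<Rightarrow> 'a \<Rightarrow> bool" where
  "ses A a B b D \<longleftrightarrow> a \<in> homset C A B \<and> b \<in> homset C B D \<and> epic C b \<and> is_kernel C b a"

lemma sesD:
  assumes "ses A a B b D"
  shows "a \<in> homset C A B" "b \<in> homset C B D" "epic C b" "b \<cdot> a = Zero C A D" "monic C a"
    "is_kernel C b a" "A \<in> Obj C" "B \<in> Obj C" "D \<in> Obj C"
proof -
  show *: "a \<in> homset C A B" "b \<in> homset C B D" "epic C b" "is_kernel C b a"
    using assms by (simp_all add: ses_def)
  then show "b \<cdot> a = Zero C A D" "monic C a" "A \<in> Obj C" "B \<in> Obj C" "D \<in> Obj C"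
    using is_kernelD[OF *(4,2)] homset_objs by (auto simp: homset_def)
qed

lemma ses_lift:
  assumes "ses A a B b D" "x \<in> homset C T B" "b \<cdot> x = Zero C T D"
  obtains y where "y \<in> homset C T A" "a \<cdot> y = x"
  using kernel_lift[OF sesD(6)[OF assms(1)] sesD(2)[OF assms(1)] assms(2,3)] sesD(1)[OF assms(1)]
  by (auto simp: homset_def)

lemma ses_descend:
  assumes "ses A a B b D" "f \<in> homset C B W" "f \<cdot> a = Zero C A W"
  obtains g where "g \<in> homset C D W" "g \<cdot> b = f"
proof (rule epic_factorization[OF sesD(3,2)[OF assms(1)] assms(2)])
  note s = sesD[OF assms(1)]
  fix T x assume x: "projective C T" "x \<in> homset C T B" "b \<cdot> x = Zero C T D"
  obtain y where y: "y \<in> homset C T A" "a \<cdot> y = x" using ses_lift[OF assms(1) x(2,3)] .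
  have "f \<cdot> (a \<cdot> y) = Zero C A W \<cdot> y"
    using comp_ext[OF assms(3), of y] y s assms(2) by (simp add: homset_def)
  then show "f \<cdot> x = Zero C T W" using y assms(2) by (auto simp: additive_simps)
qed (rule that)

lemma epic_ses:
  assumes "epic C b" "b \<in> homset C B D"
  obtains K k where "ses K k B b D"
proof -
  obtain k where "is_kernel C b k" using ex_kernel assms(2) by (auto simp: homset_def)
  then have "ses (Dom C k) k B b D" using assms is_kernelD unfolding ses_def by blast
  then show ?thesis by (rule that)
qed

lemma projective_ses:
  assumes "X \<in> Obj C"
  obtains K m P e where "projective C P" "ses K m P e X"
  using projective_cover[OF assms] epic_ses by metis

section \<open>Retracts modulo projectives, and independence of the chosen syzygies\<close>

text \<open>Retraction in the stable category: \<open>b \<cdot> a\<close> is the identity up to a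
  map that factors through the projective \<open>R\<close>.\<close>

definition stable_retract :: "'a \<Rightarrow> 'a \<Rightarrow> bool" where
  "stable_retract X X' \<longleftrightarrow> (\<exists>a b R s t. a \<in> homset C X X' \<and> b \<in> homset C X' X \<and>
     projective C R \<and> t \<in> homset C X R \<and> s \<in> homset C R X \<and> b \<cdot> a \<boxplus> s \<cdot> t = Id C X)"

lemma retract_stable_retract:
  assumes "a \<in> homset C X X'" "b \<in> homset C X' X" "b \<cdot> a = Id C X"
  shows "stable_retract X X'"
proof -
  have X: "X \<in> Obj C" using assms homset_objs by blast
  \<comment> \<open>Any projective will do, since the two maps through it are taken to be zero; a
    cover of \<open>X\<close> provides one.\<close>
  obtain R r where R: "projective C R" "r \<in> homset C R X" using projective_cover[OF X] by blast
  have "R \<in> Obj C" using R by (simp add: projective_def)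
  then have z: "Zero C X R \<in> homset C X R" "Zero C R X \<in> homset C R X"
    "b \<cdot> a \<boxplus> Zero C R X \<cdot> Zero C X R = Id C X"
    using X assms by (auto simp: additive_simps)
  then show ?thesis unfolding stable_retract_def using assms R(1) by blast
qed

lemma stable_retract_refl: "X \<in> Obj C \<Longrightarrow> stable_retract X X"
  using retract_stable_retract[of "Id C X" X X "Id C X"] by (simp add: additive_simps)

text \<open>\<open>a\<close>, \<open>b\<close> and \<open>s\<close> are lifted to the covers. The
  lifts combine to an endomorphism \<open>w\<close> of \<open>P\<close> over the identity of
  \<open>X\<close>, so the identity of \<open>P\<close> differs from \<open>w\<close> by a map into
  the syzygy, which is \<open>c\<close>. Restriction to \<open>K\<close> gives the last identity, in
  which the correction \<open>c \<cdot> m\<close> factors through the projective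
  \<open>P\<close>.\<close>

lemma stable_retract_syzygy_maps:
  assumes "stable_retract X X'" "projective C P" "ses K m P p X" "projective C Q" "ses L l Q q X'"
  obtains a0 a1 b1 c where "a0 \<in> homset C P Q" "a1 \<in> homset C K L" "b1 \<in> homset C L K"
    "c \<in> homset C P K" "l \<cdot> a1 = a0 \<cdot> m" "b1 \<cdot> a1 \<boxplus> c \<cdot> m = Id C K"
proof -
  note S = sesD[OF assms(3)] and S' = sesD[OF assms(5)]
  obtain a b R s t where ab: "a \<in> homset C X X'" "b \<in> homset C X' X" "projective C R"
    "t \<in> homset C X R" "s \<in> homset C R X" and id: "b \<cdot> a \<boxplus> s \<cdot> t = Id C X"
    using assms(1) unfolding stable_retract_def by blast
  obtain a0 where a0: "a0 \<in> homset C P Q" "q \<cdot> a0 = a \<cdot> p"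
    using projective_lift[OF assms(2) S'(3,2) comp_hom[OF S(2) ab(1)]] .
  obtain b0 where b0: "b0 \<in> homset C Q P" "p \<cdot> b0 = b \<cdot> q"
    using projective_lift[OF assms(4) S(3,2) comp_hom[OF S'(2) ab(2)]] .
  obtain s' where s': "s' \<in> homset C R P" "p \<cdot> s' = s" using projective_lift[OF ab(3) S(3,2) ab(5)] .
  define w where "w = b0 \<cdot> a0 \<boxplus> s' \<cdot> (t \<cdot> p)"
  have w: "w \<in> homset C P P" unfolding w_def using a0 b0 s' ab S by (simp add: additive_simps)
  have "p \<cdot> w = p \<cdot> (b0 \<cdot> a0) \<boxplus> p \<cdot> (s' \<cdot> (t \<cdot> p))"
    unfolding w_def using a0 b0 s' ab S by (simp add: additive_simps)
  also have "p \<cdot> (b0 \<cdot> a0) = b \<cdot> q \<cdot> a0"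
    using comp_ext[OF b0(2), of a0] a0 b0 S by (simp add: homset_def)
  also have "\<dots> = b \<cdot> a \<cdot> p" using a0 S S' ab by (simp add: additive_simps)
  also have "p \<cdot> (s' \<cdot> (t \<cdot> p)) = s \<cdot> (t \<cdot> p)"
    using comp_ext[OF s'(2), of "t \<cdot> p"] s' ab S by (simp add: additive_simps)
  also have "\<dots> = s \<cdot> t \<cdot> p" using ab S by (simp add: additive_simps)
  also have "b \<cdot> a \<cdot> p \<boxplus> s \<cdot> t \<cdot> p = Id C X \<cdot> p"
    unfolding id[symmetric] using ab S by (simp add: additive_simps)
  finally have pw: "p \<cdot> w = p" using S by (simp add: additive_simps)
  obtain d where d: "d \<in> homset C P P" "Id C P = w \<boxplus> d"
    using difference[OF id_hom[OF S(8)] w] .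
  have "p \<cdot> w \<boxplus> p \<cdot> d = p \<cdot> (w \<boxplus> d)" using w d(1) S comp_add by metis
  also have "\<dots> = p \<boxplus> Zero C P X" unfolding d(2)[symmetric] using S by (simp add: additive_simps)
  finally have "p \<cdot> d = Zero C P X"
    unfolding pw
    using add_left_cancel_hom[OF S(2) comp_hom[OF d(1) S(2)] zero_hom[OF S(8,9)]] by blast
  then obtain c where c: "c \<in> homset C P K" "m \<cdot> c = d" using ses_lift[OF assms(3) d(1)] by blast
  have "q \<cdot> (a0 \<cdot> m) = a \<cdot> p \<cdot> m"
    using comp_ext[OF a0(2), of m] a0 S S' by (simp add: homset_def)
  also have "\<dots> = Zero C K X'" using ab S S' by (simp add: additive_simps)
  finally obtain a1 where a1: "a1 \<in> homset C K L" "l \<cdot> a1 = a0 \<cdot> m"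
    using ses_lift[OF assms(5) comp_hom[OF S(1) a0(1)]] by blast
  have "p \<cdot> (b0 \<cdot> l) = b \<cdot> q \<cdot> l"
    using comp_ext[OF b0(2), of l] b0 S S' by (simp add: homset_def)
  also have "\<dots> = Zero C L X" using ab S S' by (simp add: additive_simps)
  finally obtain b1 where b1: "b1 \<in> homset C L K" "m \<cdot> b1 = b0 \<cdot> l"
    using ses_lift[OF assms(3) comp_hom[OF S'(1) b0(1)]] by blast
  have ida: "b1 \<cdot> a1 \<boxplus> c \<cdot> m \<in> homset C K K" using a1 b1 c S by (simp add: additive_simps)
  have "m \<cdot> (b1 \<cdot> a1 \<boxplus> c \<cdot> m) = m \<cdot> (b1 \<cdot> a1) \<boxplus> m \<cdot> (c \<cdot> m)"
    using a1 b1 c S by (simp add: additive_simps)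
  also have "m \<cdot> (b1 \<cdot> a1) = b0 \<cdot> l \<cdot> a1"
    using comp_ext[OF b1(2), of a1] a1 b1 S by (simp add: homset_def)
  also have "\<dots> = b0 \<cdot> (a0 \<cdot> m)" using a1 b0 S' by (simp add: additive_simps)
  \<comment> \<open>The second summand of \<open>w\<close> ends in \<open>p\<close> on the right and
    vanishes on \<open>m\<close>.\<close>
  also have "b0 \<cdot> (a0 \<cdot> m) = w \<cdot> m"
    unfolding w_def using a0 b0 s' ab S by (simp add: additive_simps)
  also have "m \<cdot> (c \<cdot> m) = d \<cdot> m" using comp_ext[OF c(2), of m] c S by (simp add: homset_def)
  also have "w \<cdot> m \<boxplus> d \<cdot> m = (w \<boxplus> d) \<cdot> m" using w d(1) S by (simp add: additive_simps)
  also have "\<dots> = m \<cdot> Id C K" unfolding d(2)[symmetric] using S by (simp add: additive_simps)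
  finally have "b1 \<cdot> a1 \<boxplus> c \<cdot> m = Id C K"
    using monicD[OF S(5) ida id_hom[OF S(7)] S(1)] by blast
  then show ?thesis using that a0 a1 b1 c by blast
qed

text \<open>The index is shifted by one: \<open>ext_vanish i X Y\<close> says that \<open>Ext\<^sup>i\<^sup>+\<^sup>1(X, Y)\<close> vanishes.\<close>

primrec ext_vanish :: "nat \<Rightarrow> 'a \<Rightarrow> 'a \<Rightarrow> bool" where
  "ext_vanish 0 = (\<lambda>X Y. \<forall>K m P e. projective C P \<longrightarrow> ses K m P e X \<longrightarrow>
     (\<forall>f \<in> homset C K Y. \<exists>g \<in> homset C P Y. g \<cdot> m = f))"
| "ext_vanish (Suc i) = (\<lambda>X Y. \<forall>K m P e. projective C P \<longrightarrow> ses K m P e X \<longrightarrow> ext_vanish i K Y)"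

declare ext_vanish.simps [simp del]

text \<open>Split \<open>f\<close> as
  \<open>f \<cdot> b1 \<cdot> a1 \<boxplus> f \<cdot> c \<cdot> m\<close>. The second summand
  visibly extends to \<open>P\<close>; for the first, extend \<open>f \<cdot> b1\<close> to
  \<open>Q\<close> and pull back along \<open>a0\<close>.\<close>

lemma stable_retract_extension:
  assumes "stable_retract X X'" "projective C P" "ses K m P p X" "projective C Q" "ses L l Q q X'"
    and ext: "\<forall>f \<in> homset C L Y. \<exists>g \<in> homset C Q Y. g \<cdot> l = f" and f: "f \<in> homset C K Y"
  shows "\<exists>g \<in> homset C P Y. g \<cdot> m = f"
proof -
  obtain a0 a1 b1 c where h: "a0 \<in> homset C P Q" "a1 \<in> homset C K L" "b1 \<in> homset C L K"
    "c \<in> homset C P K" "l \<cdot> a1 = a0 \<cdot> m" "b1 \<cdot> a1 \<boxplus> c \<cdot> m = Id C K"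
    using stable_retract_syzygy_maps[OF assms(1-5)] .
  note S = sesD[OF assms(3)] and S' = sesD[OF assms(5)]
  obtain g where g: "g \<in> homset C Q Y" "g \<cdot> l = f \<cdot> b1"
    using ext comp_hom[OF h(3) f] by blast
  have "(g \<cdot> a0 \<boxplus> f \<cdot> c) \<cdot> m = g \<cdot> (a0 \<cdot> m) \<boxplus> f \<cdot> (c \<cdot> m)"
    using g h(1-4) f S by (simp add: additive_simps)
  also have "g \<cdot> (a0 \<cdot> m) = f \<cdot> b1 \<cdot> a1"
    unfolding h(5)[symmetric] using comp_ext[OF g(2), of a1] g h S' by (simp add: homset_def)
  also have "f \<cdot> b1 \<cdot> a1 \<boxplus> f \<cdot> (c \<cdot> m) = f \<cdot> (b1 \<cdot> a1 \<boxplus> c \<cdot> m)"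
    using h(1-4) f S by (simp add: additive_simps)
  also have "\<dots> = f" unfolding h(6) using f by (simp add: additive_simps)
  finally have "(g \<cdot> a0 \<boxplus> f \<cdot> c) \<cdot> m = f" .
  moreover have "g \<cdot> a0 \<boxplus> f \<cdot> c \<in> homset C P Y" using g h f by (simp add: additive_simps)
  ultimately show ?thesis by blast
qed

lemma stable_retract_syzygy:
  assumes "stable_retract X X'" "projective C P" "ses K m P p X" "projective C Q" "ses L l Q q X'"
  shows "stable_retract K L"
proof -
  obtain a0 a1 b1 c where "a0 \<in> homset C P Q" "a1 \<in> homset C K L" "b1 \<in> homset C L K"
    "c \<in> homset C P K" "l \<cdot> a1 = a0 \<cdot> m" "b1 \<cdot> a1 \<boxplus> c \<cdot> m = Id C K"
    using stable_retract_syzygy_maps[OF assms] .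
  then show ?thesis unfolding stable_retract_def using assms(2) sesD(1)[OF assms(3)] by blast
qed

text \<open>The definition quantifies over all presentations of \<open>X\<close>. One is enough
  because \<open>X\<close> is a stable retract of itself, which compares any two of them.\<close>

lemma ext_vanish_0_iff:
  assumes "projective C P" "ses K m P e X"
  shows "ext_vanish 0 X Y \<longleftrightarrow> (\<forall>f \<in> homset C K Y. \<exists>g \<in> homset C P Y. g \<cdot> m = f)"
proof
  show "ext_vanish 0 X Y \<Longrightarrow> \<forall>f \<in> homset C K Y. \<exists>g \<in> homset C P Y. g \<cdot> m = f"
    using assms unfolding ext_vanish.simps by blast
  assume ext: "\<forall>f \<in> homset C K Y. \<exists>g \<in> homset C P Y. g \<cdot> m = f"
  have X: "stable_retract X X" using stable_retract_refl sesD(9)[OF assms(2)] .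
  show "ext_vanish 0 X Y"
    unfolding ext_vanish.simps
    by (intro allI impI ballI) (rule stable_retract_extension[OF X _ _ assms ext])
qed

lemma ext_vanish_stable_retract:
  "stable_retract X X' \<Longrightarrow> ext_vanish i X' Y \<Longrightarrow> ext_vanish i X Y"
proof (induction i arbitrary: X X')
  case 0
  then have "X' \<in> Obj C" using homset_objs unfolding stable_retract_def by blast
  then obtain L l Q q where Q: "projective C Q" "ses L l Q q X'" by (rule projective_ses)
  have ext: "\<forall>f \<in> homset C L Y. \<exists>g \<in> homset C Q Y. g \<cdot> l = f"
    using 0(2) ext_vanish_0_iff[OF Q] by simp
  show ?case
    unfolding ext_vanish.simps
    by (intro allI impI ballI) (rule stable_retract_extension[OF 0(1) _ _ Q ext])
next
  case (Suc i)
  then have "X' \<in> Obj C" using homset_objs unfolding stable_retract_def by blast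
  then obtain L l Q q where Q: "projective C Q" "ses L l Q q X'" by (rule projective_ses)
  have ev: "ext_vanish i L Y" using Suc.prems(2) Q unfolding ext_vanish.simps by blast
  show ?case
    unfolding ext_vanish.simps
    by (intro allI impI) (rule Suc.IH[OF stable_retract_syzygy[OF Suc.prems(1) _ _ Q] ev])
qed

lemma ext_vanish_Suc_iff:
  assumes "projective C P" "ses K m P e X"
  shows "ext_vanish (Suc i) X Y \<longleftrightarrow> ext_vanish i K Y"
proof
  show "ext_vanish (Suc i) X Y \<Longrightarrow> ext_vanish i K Y"
    using assms unfolding ext_vanish.simps by blast
  assume ev: "ext_vanish i K Y"
  have X: "stable_retract X X" using stable_retract_refl sesD(9)[OF assms(2)] .
  show "ext_vanish (Suc i) X Y"
    unfolding ext_vanish.simps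
    by (intro allI impI) (rule ext_vanish_stable_retract[OF stable_retract_syzygy[OF X _ _ assms] ev])
qed


section \<open>Extending maps along short exact sequences\<close>

text \<open>Extends the defining property from projective presentations to every sequence ending in
  \<open>X\<close>. Here \<open>M\<close> is the pushout of \<open>P\<close> and \<open>L\<close>
  along \<open>K\<close>, and the wanted map is \<open>h\<close> on \<open>P\<close> and
  \<open>f\<close> on \<open>L\<close>. The pushout is not formed: the map is written down as
  \<open>F\<close> on a projective cover \<open>Q\<close> of \<open>M\<close> and then shown to
  descend.\<close>

lemma ext_vanish_extend:
  assumes "ses L n M g X" "ext_vanish 0 X Y" "f \<in> homset C L Y"
  obtains h where "h \<in> homset C M Y" "h \<cdot> n = f"
proof -
  note S = sesD[OF assms(1)]
  obtain K m P e where P: "projective C P" "ses K m P e X" using projective_ses[OF S(9)] .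
  note SP = sesD[OF P(2)]
  obtain Q q where Q: "projective C Q" "q \<in> homset C Q M" "epic C q" using projective_cover[OF S(8)] .
  obtain u where u: "u \<in> homset C P M" "g \<cdot> u = e" using projective_lift[OF P(1) S(3,2) SP(2)] .
  obtain w where w: "w \<in> homset C Q P" "e \<cdot> w = g \<cdot> q"
    using projective_lift[OF Q(1) SP(3,2) comp_hom[OF Q(2) S(2)]] .
  have "g \<cdot> (u \<cdot> m) = e \<cdot> m" using comp_ext[OF u(2), of m] u S SP by (simp add: homset_def)
  then obtain u' where u': "u' \<in> homset C K L" "n \<cdot> u' = u \<cdot> m"
    using ses_lift[OF assms(1) comp_hom[OF SP(1) u(1)]] SP(4) by metis
  obtain h where h: "h \<in> homset C P Y" "h \<cdot> m = f \<cdot> u'"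
    using assms(2) P comp_hom[OF u'(1) assms(3)] unfolding ext_vanish.simps by blast
  have uw: "u \<cdot> w \<in> homset C Q M" using comp_hom[OF w(1) u(1)] .
  \<comment> \<open>\<open>q\<close> and \<open>u \<cdot> w\<close> agree after \<open>g\<close>, so
    their difference \<open>d\<close> factors through \<open>L\<close>, as
    \<open>n \<cdot> r\<close>.\<close>
  obtain d where d: "d \<in> homset C Q M" "q = u \<cdot> w \<boxplus> d" using difference[OF Q(2) uw] .
  have gq: "g \<cdot> q \<in> homset C Q X" using comp_hom[OF Q(2) S(2)] .
  have "g \<cdot> q \<boxplus> g \<cdot> d = g \<cdot> (u \<cdot> w) \<boxplus> g \<cdot> d"
    using comp_ext[OF u(2), of w] w u S SP by (simp add: homset_def)
  also have "\<dots> = g \<cdot> q" unfolding d(2) using comp_add[OF uw d(1) S(2)] by simp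
  also have "\<dots> = g \<cdot> q \<boxplus> Zero C Q X" using gq by (simp add: additive_simps)
  finally have "g \<cdot> d = Zero C Q X"
    using add_left_cancel_hom[OF gq comp_hom[OF d(1) S(2)] zero_hom] homset_objs[OF gq] by blast
  then obtain r where r: "r \<in> homset C Q L" "n \<cdot> r = d" using ses_lift[OF assms(1) d(1)] by blast
  define F where "F = h \<cdot> w \<boxplus> f \<cdot> r"
  have F: "F \<in> homset C Q Y" unfolding F_def using h w r assms(3) by (simp add: additive_simps)
  \<comment> \<open>On elements of \<open>Q\<close> that lie over \<open>L\<close>, \<open>F\<close>
    takes the value prescribed by \<open>f\<close>. With \<open>y\<close> zero this lets
    \<open>F\<close> descend to \<open>M\<close>; with \<open>z\<close> a lift of
    \<open>n \<cdot> y\<close> it shows that the descended map extends \<open>f\<close>.\<close>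
  have key: "F \<cdot> z = f \<cdot> y"
    if z: "z \<in> homset C T Q" and y: "y \<in> homset C T L" and yz: "n \<cdot> y = q \<cdot> z" for T y z
  proof -
    have "e \<cdot> (w \<cdot> z) = g \<cdot> q \<cdot> z" using comp_ext[OF w(2), of z] w z SP by (simp add: homset_def)
    also have "\<dots> = g \<cdot> (n \<cdot> y)" unfolding yz using z Q S by (simp add: additive_simps)
    also have "\<dots> = Zero C L X \<cdot> y" using comp_ext[OF S(4), of y] y S(1,2) by (simp add: homset_def)
    also have "\<dots> = Zero C T X" using y S by (simp add: additive_simps)
    finally obtain t where t: "t \<in> homset C T K" "m \<cdot> t = w \<cdot> z"
      using ses_lift[OF P(2) comp_hom[OF z w(1)]] by blast
    have ty: "u' \<cdot> t \<boxplus> r \<cdot> z \<in> homset C T L" using t u' r z by (simp add: additive_simps)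
    have "n \<cdot> y = u \<cdot> w \<cdot> z \<boxplus> d \<cdot> z" unfolding yz d(2) using add_comp[OF z uw d(1)] .
    also have "u \<cdot> w \<cdot> z = u \<cdot> (m \<cdot> t)" unfolding t(2) using u w z by (simp add: additive_simps)
    also have "\<dots> = u \<cdot> m \<cdot> t" using t u SP by (simp add: additive_simps)
    also have "\<dots> = n \<cdot> (u' \<cdot> t)" unfolding u'(2)[symmetric] using t(1) u'(1) S by (simp add: additive_simps)
    also have "d \<cdot> z = n \<cdot> (r \<cdot> z)" unfolding r(2)[symmetric] using r(1) z S by (simp add: additive_simps)
    also have "n \<cdot> (u' \<cdot> t) \<boxplus> n \<cdot> (r \<cdot> z) = n \<cdot> (u' \<cdot> t \<boxplus> r \<cdot> z)"
      using r(1) z S u'(1) t(1) by (simp add: additive_simps)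
    finally have y': "y = u' \<cdot> t \<boxplus> r \<cdot> z" using monicD[OF S(5) y ty S(1)] by blast
    have "F \<cdot> z = h \<cdot> w \<cdot> z \<boxplus> f \<cdot> r \<cdot> z"
      unfolding F_def using h(1) w(1) r(1) z assms(3) by (simp add: additive_simps)
    also have "h \<cdot> w \<cdot> z = h \<cdot> (m \<cdot> t)" unfolding t(2) using h(1) w(1) z by (simp add: additive_simps)
    also have "\<dots> = f \<cdot> u' \<cdot> t" using comp_ext[OF h(2), of t] h t SP by (simp add: homset_def)
    also have "f \<cdot> u' \<cdot> t \<boxplus> f \<cdot> r \<cdot> z = f \<cdot> (u' \<cdot> t \<boxplus> r \<cdot> z)"
      using r(1) z u'(1) t(1) assms(3) by (simp add: additive_simps)
    finally show ?thesis unfolding y' .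
  qed
  have Y: "Y \<in> Obj C" using F homset_objs by blast
  obtain G where G: "G \<in> homset C M Y" "G \<cdot> q = F"
  proof (rule epic_factorization[OF Q(3,2) F])
    fix T x assume x: "projective C T" "x \<in> homset C T Q" "q \<cdot> x = Zero C T M"
    have T: "T \<in> Obj C" using x homset_objs by blast
    have "n \<cdot> Zero C T L = q \<cdot> x" using x T S by (simp add: additive_simps)
    then have "F \<cdot> x = f \<cdot> Zero C T L" using key[OF x(2) zero_hom[OF T S(7)]] by blast
    then show "F \<cdot> x = Zero C T Y" using T assms(3) by (simp add: additive_simps)
  qed
  have "G \<cdot> n = f"
  proof (rule eq_on_projectives[OF comp_hom[OF S(1) G(1)] assms(3)])
    fix T y assume y: "projective C T" "y \<in> homset C T L"
    obtain z where z: "z \<in> homset C T Q" "q \<cdot> z = n \<cdot> y"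
      using projective_lift[OF y(1) Q(3,2) comp_hom[OF y(2) S(1)]] .
    have "G \<cdot> n \<cdot> y = G \<cdot> (q \<cdot> z)" unfolding z(2) using G y S by (simp add: additive_simps)
    also have "\<dots> = F \<cdot> z" using comp_ext[OF G(2), of z] G z Q by (simp add: homset_def)
    also have "\<dots> = f \<cdot> y" using key[OF z(1) y(2) z(2)[symmetric]] .
    finally show "G \<cdot> n \<cdot> y = f \<cdot> y" .
  qed
  with G show ?thesis using that by blast
qed

section \<open>Rotation of short exact sequences and dimension shifting\<close>

text \<open>One projective \<open>P\<close> covers both \<open>B\<close> and \<open>D\<close>. The
  kernel \<open>L\<close> of \<open>P -> D\<close> contains the kernel \<open>K\<close> of
  \<open>P -> B\<close>, and the quotient is \<open>A\<close>. Thus \<open>K\<close> and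
  \<open>L\<close> are syzygies of \<open>B\<close> and \<open>D\<close>, and passing to them lowers
  the degree of \<open>ext_vanish\<close> by one.\<close>

lemma ses_rotate:
  assumes "ses A a B b D"
  obtains P p K k L l u v where "projective C P" "ses K k P p B" "ses L l P (b \<cdot> p) D"
    "ses K u L v A" "l \<cdot> u = k" "a \<cdot> v = p \<cdot> l"
proof -
  note S = sesD[OF assms]
  obtain K k P p where P: "projective C P" "ses K k P p B" using projective_ses[OF S(8)] .
  note K = sesD[OF P(2)]
  have bp: "b \<cdot> p \<in> homset C P D" using comp_hom[OF K(2) S(2)] .
  obtain L l where Ll: "ses L l P (b \<cdot> p) D" using epic_ses[OF epic_comp[OF K(3) S(3) K(2) S(2)] bp] .
  note L = sesD[OF Ll]
  have "b \<cdot> p \<cdot> k = Zero C K D" using K S by (simp add: additive_simps)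
  then obtain u where u: "u \<in> homset C K L" "l \<cdot> u = k" using ses_lift[OF Ll K(1)] by blast
  have "b \<cdot> (p \<cdot> l) = Zero C L D" using L(1,4) K S by (simp add: additive_simps)
  then obtain v where v: "v \<in> homset C L A" "a \<cdot> v = p \<cdot> l"
    using ses_lift[OF assms comp_hom[OF L(1) K(2)]] by blast
  have avx: "a \<cdot> (v \<cdot> x) = p \<cdot> (l \<cdot> x)" if "x \<in> homset C T L" for T x
    using comp_ext[OF v(2), of x] that v S L K by (simp add: additive_simps)
  have "ses K u L v A"
    unfolding ses_def
  proof (intro conjI)
    show "u \<in> homset C K L" "v \<in> homset C L A" using u v by auto
    show "epic C v"
    proof (rule epicI_projective[OF v(1)])
      fix T x assume x: "projective C T" "x \<in> homset C T A"
      have T: "T \<in> Obj C" using x homset_objs by blast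
      \<comment> \<open>A preimage in \<open>P\<close> of \<open>a \<cdot> x\<close> is annihilated
        by \<open>b \<cdot> p\<close>, so it comes from \<open>L\<close>.\<close>
      obtain z where z: "z \<in> homset C T P" "p \<cdot> z = a \<cdot> x"
        using projective_lift[OF x(1) K(3,2) comp_hom[OF x(2) S(1)]] .
      have "b \<cdot> p \<cdot> z = b \<cdot> (a \<cdot> x)" unfolding z(2)[symmetric] using z(1) K S by (simp add: additive_simps)
      also have "\<dots> = Zero C A D \<cdot> x" using comp_ext[OF S(4), of x] x S(1,2) by (simp add: homset_def)
      also have "\<dots> = Zero C T D" using x S by (simp add: additive_simps)
      finally obtain y where y: "y \<in> homset C T L" "l \<cdot> y = z" using ses_lift[OF Ll z(1)] by blast
      have "a \<cdot> (v \<cdot> y) = a \<cdot> x" using avx[OF y(1)] y z by simp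
      then have "v \<cdot> y = x" using monicD[OF S(5) comp_hom[OF y(1) v(1)] x(2) S(1)] by blast
      then show "\<exists>y \<in> homset C T L. v \<cdot> y = x" using y by blast
    qed
    show "is_kernel C v u"
    proof (rule is_kernelI[OF v(1) u(1)])
      have "a \<cdot> (v \<cdot> u) = Zero C K B" using avx[OF u(1)] u K by simp
      then show "v \<cdot> u = Zero C K A" using monic_comp_zeroD[OF S(5,1) comp_hom[OF u(1) v(1)]] by blast
      show "monic C u"
      proof (rule monic_homI[OF u(1)])
        fix T x assume x: "x \<in> homset C T K" "u \<cdot> x = Zero C T L"
        have T: "T \<in> Obj C" using x homset_objs by blast
        have "k \<cdot> x = l \<cdot> (u \<cdot> x)" using comp_ext[OF u(2), of x] u x L by (simp add: homset_def)
        also have "\<dots> = Zero C T P" unfolding x(2) using L T by (simp add: additive_simps)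
        finally show "x = Zero C T K" using monic_comp_zeroD[OF K(5,1) x(1)] by blast
      qed
      fix T x assume x: "x \<in> homset C T L" "v \<cdot> x = Zero C T A"
      have T: "T \<in> Obj C" using x homset_objs by blast
      have "p \<cdot> (l \<cdot> x) = a \<cdot> Zero C T A" using avx[OF x(1)] x(2) by simp
      also have "\<dots> = Zero C T B" using S T by (simp add: additive_simps)
      finally obtain y where y: "y \<in> homset C T K" "k \<cdot> y = l \<cdot> x"
        using ses_lift[OF P(2) comp_hom[OF x(1) L(1)]] by blast
      have "l \<cdot> (u \<cdot> y) = l \<cdot> x" using comp_ext[OF u(2), of y] u y L by (simp add: homset_def)
      then have "u \<cdot> y = x" using monicD[OF L(5) comp_hom[OF y(1) u(1)] x(1) L(1)] by blast
      then show "\<exists>y \<in> homset C T K. u \<cdot> y = x" using y by blast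
    qed
  qed
  then show ?thesis using that P Ll u(2) v(2) by blast
qed

text \<open>Fragments of the long exact sequence. Rotating a short exact sequence permutes the three
  statements cyclically and lowers the degree; only degree 0 needs an argument.\<close>

lemma ext_vanish_middle_0:
  assumes "ses A a B b D" "ext_vanish 0 A Y" "ext_vanish 0 D Y"
  shows "ext_vanish 0 B Y"
proof -
  obtain P p K k L l u v where P: "projective C P" "ses K k P p B" "ses L l P (b \<cdot> p) D"
    "ses K u L v A" "l \<cdot> u = k" "a \<cdot> v = p \<cdot> l"
    using ses_rotate[OF assms(1)] .
  have "\<exists>g \<in> homset C P Y. g \<cdot> k = f" if f: "f \<in> homset C K Y" for f
  proof -
    \<comment> \<open>The extension is made in two stages, from \<open>K\<close> to \<open>L\<close>
      and from \<open>L\<close> to \<open>P\<close>, along the sequences ending in \<open>A\<close>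
      and in \<open>D\<close>.\<close>
    obtain f' where f': "f' \<in> homset C L Y" "f' \<cdot> u = f"
      using ext_vanish_extend[OF P(4) assms(2) f] .
    obtain g where g: "g \<in> homset C P Y" "g \<cdot> l = f'"
      using ext_vanish_extend[OF P(3) assms(3) f'(1)] .
    have "g \<cdot> (l \<cdot> u) = f' \<cdot> u"
      using comp_ext[OF g(2), of u] g sesD(1)[OF P(3)] sesD(1)[OF P(4)] by (simp add: homset_def)
    then show ?thesis using g f' P(5) by auto
  qed
  then show ?thesis using ext_vanish_0_iff[OF P(1,2)] by blast
qed

text \<open>For \<open>f\<close> on \<open>L\<close>, first extend its restriction to
  \<open>K\<close> to a map \<open>h\<close> on \<open>P\<close>. What remains of \<open>f\<close>
  after subtracting \<open>h \<cdot> l\<close> vanishes on \<open>K\<close>, so it comes from a map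
  on \<open>A\<close>; this extends to \<open>B\<close> by hypothesis and is pulled back to
  \<open>P\<close> along \<open>p\<close>.\<close>

lemma ext_vanish_right_of_extension:
  assumes "ses A a B b D" "ext_vanish 0 B Y"
    and ext: "\<And>f. f \<in> homset C A Y \<Longrightarrow> \<exists>g \<in> homset C B Y. g \<cdot> a = f"
  shows "ext_vanish 0 D Y"
proof -
  obtain P p K k L l u v where P: "projective C P" "ses K k P p B" "ses L l P (b \<cdot> p) D"
    "ses K u L v A" "l \<cdot> u = k" "a \<cdot> v = p \<cdot> l"
    using ses_rotate[OF assms(1)] .
  note S = sesD[OF assms(1)] and SK = sesD[OF P(2)] and SL = sesD[OF P(3)] and SA = sesD[OF P(4)]
  have "\<exists>g \<in> homset C P Y. g \<cdot> l = f" if f: "f \<in> homset C L Y" for f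
  proof -
    have Y: "Y \<in> Obj C" using f homset_objs by blast
    have fu: "f \<cdot> u \<in> homset C K Y" using comp_hom[OF SA(1) f] .
    obtain h where h: "h \<in> homset C P Y" "h \<cdot> k = f \<cdot> u" using ext_vanish_extend[OF P(2) assms(2) fu] .
    have hl: "h \<cdot> l \<in> homset C L Y" using comp_hom[OF SL(1) h(1)] .
    obtain d where d: "d \<in> homset C L Y" "f = h \<cdot> l \<boxplus> d" using difference[OF f hl] .
    have "f \<cdot> u \<boxplus> d \<cdot> u = h \<cdot> l \<cdot> u \<boxplus> d \<cdot> u"
      unfolding h(2)[symmetric] P(5)[symmetric] using h(1) SL(1) SA(1) by (simp add: additive_simps)
    also have "\<dots> = f \<cdot> u" unfolding d(2) using add_comp[OF SA(1) hl d(1)] by simp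
    also have "\<dots> = f \<cdot> u \<boxplus> Zero C K Y" using fu by (simp add: additive_simps)
    finally have "d \<cdot> u = Zero C K Y"
      using add_left_cancel_hom[OF fu comp_hom[OF SA(1) d(1)] zero_hom[OF SA(7) Y]] by blast
    then obtain w where w: "w \<in> homset C A Y" "w \<cdot> v = d" using ses_descend[OF P(4) d(1)] by blast
    obtain g where g: "g \<in> homset C B Y" "g \<cdot> a = w" using ext[OF w(1)] by blast
    have "(h \<boxplus> g \<cdot> p) \<cdot> l = h \<cdot> l \<boxplus> g \<cdot> (p \<cdot> l)"
      using h(1) g(1) SL(1) SK(2) by (simp add: additive_simps)
    also have "g \<cdot> (p \<cdot> l) = w \<cdot> v"
      unfolding P(6)[symmetric] using comp_ext[OF g(2), of v] g(1) S(1) SA(2) by (simp add: homset_def)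
    finally have "(h \<boxplus> g \<cdot> p) \<cdot> l = f" unfolding w(2) d(2) .
    then show ?thesis using add_hom[OF h(1) comp_hom[OF SK(2) g(1)]] by blast
  qed
  then show ?thesis using ext_vanish_0_iff[OF P(1,3)] by blast
qed

text \<open>The preceding lemma for the rotated sequence: its middle term \<open>L\<close> is a
  syzygy of \<open>D\<close>, and maps on \<open>K\<close> extend to \<open>L\<close> because they
  even extend to \<open>P\<close>.\<close>

lemma ext_vanish_left_0:
  assumes "ses A a B b D" "ext_vanish 0 B Y" "ext_vanish (Suc 0) D Y"
  shows "ext_vanish 0 A Y"
proof -
  obtain P p K k L l u v where P: "projective C P" "ses K k P p B" "ses L l P (b \<cdot> p) D"
    "ses K u L v A" "l \<cdot> u = k" "a \<cdot> v = p \<cdot> l"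
    using ses_rotate[OF assms(1)] .
  show ?thesis
  proof (rule ext_vanish_right_of_extension[OF P(4)])
    show "ext_vanish 0 L Y" using assms(3) ext_vanish_Suc_iff[OF P(1,3)] by blast
    fix f assume f: "f \<in> homset C K Y"
    obtain g where g: "g \<in> homset C P Y" "g \<cdot> k = f" using ext_vanish_extend[OF P(2) assms(2) f] .
    have "g \<cdot> l \<cdot> u = f"
      using g sesD(1)[OF P(3)] sesD(1)[OF P(4)] P(5) by (simp add: additive_simps)
    then show "\<exists>g \<in> homset C L Y. g \<cdot> u = f" using comp_hom[OF sesD(1)[OF P(3)] g(1)] by blast
  qed
qed

text \<open>The statement about middle terms is a hypothesis, so that the lemma is available inside
  the induction that proves that statement.\<close>

lemma ext_vanish_right_of_middle:
  assumes middle: "\<And>A a B b D. \<lbrakk>ses A a B b D; ext_vanish i A Y; ext_vanish i D Y\<rbrakk> \<Longrightarrow> ext_vanish i B Y"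
    and "ses A a B b D" "ext_vanish i A Y" "ext_vanish (Suc i) B Y"
  shows "ext_vanish (Suc i) D Y"
proof -
  obtain P p K k L l u v where P: "projective C P" "ses K k P p B" "ses L l P (b \<cdot> p) D"
    "ses K u L v A" "l \<cdot> u = k" "a \<cdot> v = p \<cdot> l"
    using ses_rotate[OF assms(2)] .
  have "ext_vanish i K Y" using assms(4) ext_vanish_Suc_iff[OF P(1,2)] by blast
  then have "ext_vanish i L Y" using middle P(4) assms(3) by blast
  then show ?thesis using ext_vanish_Suc_iff[OF P(1,3)] by blast
qed

text \<open>The two claims need a joint induction. After rotation, the middle claim in degree
  \<open>i + 1\<close> is the left claim in degree \<open>i\<close>, while the left claim in degree
  \<open>i + 1\<close> is the one about right-hand terms, which rests on the middle claim in degree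
  \<open>i\<close>.\<close>

lemma ext_vanish_middle_left:
  "(\<forall>A a B b D. ses A a B b D \<longrightarrow> ext_vanish i A Y \<longrightarrow> ext_vanish i D Y \<longrightarrow> ext_vanish i B Y) \<and>
   (\<forall>A a B b D. ses A a B b D \<longrightarrow> ext_vanish i B Y \<longrightarrow> ext_vanish (Suc i) D Y \<longrightarrow> ext_vanish i A Y)"
proof (induction i)
  case 0
  show ?case using ext_vanish_middle_0 ext_vanish_left_0 by blast
next
  case (Suc i)
  have middle: "ext_vanish i B Y" if "ses A a B b D" "ext_vanish i A Y" "ext_vanish i D Y" for A a B b D
    using Suc.IH that by blast
  have left: "ext_vanish i A Y" if "ses A a B b D" "ext_vanish i B Y" "ext_vanish (Suc i) D Y" for A a B b D
    using Suc.IH that by blast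
  show ?case
  proof (intro conjI allI impI)
    fix A a B b D
    assume s: "ses A a B b D" and ev: "ext_vanish (Suc i) A Y" "ext_vanish (Suc i) D Y"
    obtain P p K k L l u v where P: "projective C P" "ses K k P p B" "ses L l P (b \<cdot> p) D"
      "ses K u L v A" "l \<cdot> u = k" "a \<cdot> v = p \<cdot> l"
      using ses_rotate[OF s] .
    show "ext_vanish (Suc i) B Y"
      using left[OF P(4) _ ev(1)] ev(2) ext_vanish_Suc_iff[OF P(1,2)] ext_vanish_Suc_iff[OF P(1,3)]
      by blast
  next
    fix A a B b D
    assume s: "ses A a B b D" and ev: "ext_vanish (Suc i) B Y" "ext_vanish (Suc (Suc i)) D Y"
    obtain P p K k L l u v where P: "projective C P" "ses K k P p B" "ses L l P (b \<cdot> p) D"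
      "ses K u L v A" "l \<cdot> u = k" "a \<cdot> v = p \<cdot> l"
      using ses_rotate[OF s] .
    have ev': "ext_vanish i K Y" "ext_vanish (Suc i) L Y"
      using ev ext_vanish_Suc_iff[OF P(1,2)] ext_vanish_Suc_iff[OF P(1,3)] by blast+
    show "ext_vanish (Suc i) A Y" by (rule ext_vanish_right_of_middle[OF _ P(4) ev']) (rule middle)
  qed
qed

lemma ext_vanish_right:
  assumes "ses A a B b D" "ext_vanish i A Y" "ext_vanish (Suc i) B Y"
  shows "ext_vanish (Suc i) D Y"
  using ext_vanish_right_of_middle[OF _ assms] ext_vanish_middle_left by blast

section \<open>Vanishing on projectives\<close>

lemma zero_object_projective:
  assumes "zero_object C Z"
  shows "projective C Z"
  unfolding projective_def
proof (intro conjI allI impI)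
  show Z: "Z \<in> Obj C" using assms by (rule zero_object_obj)
  fix e f assume ef: "epic C e \<and> f \<in> homset C Z (Cod C e)"
  then have e: "e \<in> Arr C" by (simp add: epic_def)
  have "e \<cdot> Zero C Z (Dom C e) = f"
    using from_zero_object[OF assms, of f "Cod C e"] ef e Z by (simp add: additive_simps)
  then show "\<exists>h\<in>homset C Z (Dom C e). e \<cdot> h = f" using zero_hom[OF Z dom_obj[OF e]] by blast
qed

text \<open>The identity presents \<open>P\<close> with a zero object as syzygy. Maps out of zero
  extend by zero, and a higher degree shifts to the zero object, which is itself projective; hence
  \<open>P\<close> is arbitrary in the induction.\<close>

lemma ext_vanish_projective: "\<lbrakk>projective C P; Y \<in> Obj C\<rbrakk> \<Longrightarrow> ext_vanish i P Y"
proof (induction i arbitrary: P)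
  have ses_id: "ses Z (Zero C Z P) P (Id C P) P" if P: "P \<in> Obj C" and Z0: "zero_object C Z" for P Z
  proof -
    have Z: "Z \<in> Obj C" using Z0 by (rule zero_object_obj)
    have "is_kernel C (Id C P) (Zero C Z P)"
    proof (rule is_kernelI[OF id_hom[OF P] zero_hom[OF Z P]])
      show "Id C P \<cdot> Zero C Z P = Zero C Z P" using P Z by (simp add: additive_simps)
      show "monic C (Zero C Z P)"
        using monic_homI[OF zero_hom[OF Z P]] to_zero_object[OF Z0] by blast
      fix T x assume x: "x \<in> homset C T P" "Id C P \<cdot> x = Zero C T P"
      have T: "T \<in> Obj C" using x homset_objs by blast
      have "Zero C Z P \<cdot> Zero C T Z = x" using x T Z P by (simp add: additive_simps)
      then show "\<exists>y\<in>homset C T Z. Zero C Z P \<cdot> y = x" using zero_hom[OF T Z] by blast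
    qed
    then show ?thesis unfolding ses_def using zero_hom id_hom id_epic P Z by blast
  qed
  obtain Z where Z: "zero_object C Z" using ex_zero_object by blast
  {
    case 0
    have P: "P \<in> Obj C" using 0 by (simp add: projective_def)
    have "\<exists>g\<in>homset C P Y. g \<cdot> Zero C Z P = f" if f: "f \<in> homset C Z Y" for f
    proof
      show "Zero C P Y \<cdot> Zero C Z P = f"
        using from_zero_object[OF Z f] P 0 zero_object_obj[OF Z] by (simp add: additive_simps)
    qed (rule zero_hom[OF P 0(2)])
    then show ?case using ext_vanish_0_iff[OF 0(1) ses_id[OF P Z]] by blast
  next
    case (Suc i)
    have P: "P \<in> Obj C" using Suc by (simp add: projective_def)
    show ?case
      using ext_vanish_Suc_iff[OF Suc(2) ses_id[OF P Z]] Suc zero_object_projective[OF Z] by blast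
  }
qed

end

section \<open>Ext and resolutions\<close>

lemma (in comm_group) trivial_FactGroup_iff:
  assumes "subgroup H G"
  shows "trivial_group (G Mod H) \<longleftrightarrow> carrier G \<subseteq> H"
proof -
  interpret Q: comm_group "G Mod H" using assms by (rule abelian_FactGroup)
  have "trivial_group (G Mod H) \<longleftrightarrow> (\<forall>x \<in> carrier G. H #> x = H)"
    unfolding Q.trivial_group_subset by (auto simp: FactGroup_def RCOSETS_def)
  also have "\<dots> \<longleftrightarrow> carrier G \<subseteq> H"
    using assms coset_join2 rcos_self by blast
  finally show ?thesis .
qed

context abelian_enough_projectives
begin

text \<open>Once cocycles and coboundaries are known to be subgroups, the quotient is trivial just
  when every cocycle is a coboundary.\<close>

lemma trivial_cohomology_iff:
  assumes d: "\<And>j. d (Suc j) \<in> homset C (P (Suc j)) (P j)"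
    and dd: "\<And>j. d (Suc j) \<cdot> d (Suc (Suc j)) = Zero C (P (Suc (Suc j))) (P j)"
    and Y: "Y \<in> Obj C"
  shows "trivial_group (cohomology C P d Y (Suc i)) \<longleftrightarrow>
    (\<forall>f \<in> homset C (P (Suc i)) Y. f \<cdot> d (Suc (Suc i)) = Zero C (P (Suc (Suc i))) Y \<longrightarrow>
      (\<exists>g \<in> homset C (P i) Y. g \<cdot> d (Suc i) = f))"
proof -
  define G where "G = hom_group C (P (Suc i)) Y"
  let ?Z = "cocycles C P d Y (Suc i)" and ?B = "coboundaries C P d Y (Suc i)"
  have P: "P j \<in> Obj C" for j using d[of j] homset_objs by blast
  interpret comm_group G unfolding G_def using P Y by (rule hom_comm_group)
  have G: "carrier G = homset C (P (Suc i)) Y" "mult G = Add C" "one G = Zero C (P (Suc i)) Y"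
    by (simp_all add: G_def)
  have inv: "inv\<^bsub>G\<^esub> f = neg f" if "f \<in> carrier G" for f
    using that by (auto simp: neg_def G_def homset_def)
  have Z: "subgroup ?Z G"
  proof (rule subgroupI)
    show "?Z \<subseteq> carrier G" by (auto simp: cocycles_def G)
    show "?Z \<noteq> {}"
      using zero_hom[OF P Y] zero_comp[of "d (Suc (Suc i))" Y] d Y
      by (fastforce simp: cocycles_def homset_def)
    fix f assume f: "f \<in> ?Z"
    then have f': "f \<in> homset C (P (Suc i)) Y" "f \<cdot> d (Suc (Suc i)) = Zero C (P (Suc (Suc i))) Y"
      by (auto simp: cocycles_def)
    have "neg f \<cdot> d (Suc (Suc i)) = neg (f \<cdot> d (Suc (Suc i)))"
      using neg_comp f' d[of "Suc i"] by (simp add: homset_def)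
    also have "\<dots> = Zero C (P (Suc (Suc i))) Y \<boxplus> neg (f \<cdot> d (Suc (Suc i)))"
      unfolding f'(2) using zero_hom[OF P Y] P Y by (simp add: additive_simps)
    also have "\<dots> = Zero C (P (Suc (Suc i))) Y"
      unfolding f'(2) using add_neg[of "Zero C (P (Suc (Suc i))) Y"] P Y by (simp add: additive_simps)
    finally show "inv\<^bsub>G\<^esub> f \<in> ?Z" using f' inv[of f] by (simp add: G cocycles_def homset_def neg_arr)
    fix g assume g: "g \<in> ?Z"
    then show "f \<otimes>\<^bsub>G\<^esub> g \<in> ?Z" using f' d[of "Suc i"] P Y by (auto simp: cocycles_def G additive_simps)
  qed
  have "subgroup ?B G"
  proof (rule subgroupI)
    show "?B \<subseteq> carrier G" using d[of i] by (auto simp: G additive_simps)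
    show "?B \<noteq> {}" using zero_hom[OF P Y] by auto
    fix f assume "f \<in> ?B"
    then obtain f' where f: "f = f' \<cdot> d (Suc i)" "f' \<in> homset C (P i) Y" by auto
    then have "neg f = neg f' \<cdot> d (Suc i)" "neg f' \<in> homset C (P i) Y" "f \<in> carrier G"
      using neg_comp d[of i] by (auto simp: homset_def G neg_arr comp_arr)
    then show "inv\<^bsub>G\<^esub> f \<in> ?B" using inv by simp
    fix g assume "g \<in> ?B"
    then obtain g' where g: "g = g' \<cdot> d (Suc i)" "g' \<in> homset C (P i) Y" by auto
    have "f \<boxplus> g = (f' \<boxplus> g') \<cdot> d (Suc i)"
      using f g d[of i] by (simp add: additive_simps)
    then show "f \<otimes>\<^bsub>G\<^esub> g \<in> ?B" using add_hom[OF f(2) g(2)] by (simp add: G)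
  qed
  moreover have "?B \<subseteq> ?Z"
  proof
    fix f assume "f \<in> ?B"
    then obtain g where g: "f = g \<cdot> d (Suc i)" "g \<in> homset C (P i) Y" by auto
    have "f \<cdot> d (Suc (Suc i)) = g \<cdot> (d (Suc i) \<cdot> d (Suc (Suc i)))"
      using g d[of i] d[of "Suc i"] by (simp add: additive_simps)
    also have "\<dots> = Zero C (P (Suc (Suc i))) Y" unfolding dd using g P by (simp add: additive_simps)
    finally show "f \<in> ?Z" using g(1) comp_hom[OF d g(2)] by (simp add: cocycles_def)
  qed
  \<comment> \<open>The quotient is formed inside the group of cocycles, so \<open>?B\<close> has to
    be a subgroup there and not merely in \<open>G\<close>.\<close>
  ultimately have B: "subgroup ?B (G\<lparr>carrier := ?Z\<rparr>)" using subgroup_incl Z by blast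
  have "comm_group (G\<lparr>carrier := ?Z\<rparr>)"
    using group.group_comm_groupI[OF subgroup_imp_group[OF Z]] m_comm subgroup.mem_carrier[OF Z] by simp
  then have "trivial_group (cohomology C P d Y (Suc i)) \<longleftrightarrow> ?Z \<subseteq> ?B"
    using comm_group.trivial_FactGroup_iff[OF _ B] by (simp add: cohomology_def G_def)
  also have "\<dots> \<longleftrightarrow> (\<forall>f \<in> homset C (P (Suc i)) Y. f \<cdot> d (Suc (Suc i)) = Zero C (P (Suc (Suc i))) Y \<longrightarrow>
      (\<exists>g \<in> homset C (P i) Y. g \<cdot> d (Suc i) = f))"
    by (auto simp: cocycles_def)
  finally show ?thesis .
qed

section \<open>Projective resolutions and their syzygies\<close>

lemma exact_step:
  assumes "d \<in> Arr C"
  shows "\<exists>d' \<in> Arr C. Cod C d' = Dom C d \<and> projective C (Dom C d') \<and> exact C d' d"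
proof -
  define X Y where "X = Dom C d" and "Y = Cod C d"
  have d: "d \<in> homset C X Y" using assms by (simp add: X_def Y_def homset_def)
  obtain m where m: "is_kernel C d m" using ex_kernel[OF assms] by blast
  define K where "K = Dom C m"
  have k: "m \<in> homset C K X" "d \<cdot> m = Zero C K Y" using is_kernelD[OF m d] by (simp_all add: K_def)
  have ob: "K \<in> Obj C" "Y \<in> Obj C" using k d homset_objs by blast+
  obtain P e where e: "projective C P" "e \<in> homset C P K" "epic C e" using projective_cover[OF ob(1)] .
  \<comment> \<open>The new differential is a projective cover of the kernel followed by the
    inclusion of the kernel.\<close>
  have me: "m \<cdot> e \<in> homset C P X" using comp_hom[OF e(2) k(1)] .
  have "exact C (m \<cdot> e) d"
  proof (rule exactI[OF me d])
    have "d \<cdot> (m \<cdot> e) = Zero C K Y \<cdot> e" using comp_ext[OF k(2), of e] e k d by (simp add: homset_def)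
    then show "d \<cdot> (m \<cdot> e) = Zero C P Y" using e ob by (simp add: additive_simps)
    fix T x assume x: "projective C T" "x \<in> homset C T X" "d \<cdot> x = Zero C T Y"
    obtain y where y: "y \<in> homset C T K" "m \<cdot> y = x"
      using kernel_lift[OF m d x(2,3)] unfolding K_def .
    obtain z where z: "z \<in> homset C T P" "e \<cdot> z = y" using projective_lift[OF x(1) e(3,2) y(1)] .
    have "m \<cdot> e \<cdot> z = x" using y(2) z e k by (simp add: additive_simps)
    then show "\<exists>y \<in> homset C T P. m \<cdot> e \<cdot> y = x" using z by blast
  qed
  then show ?thesis using me e(1) unfolding X_def by (auto simp: homset_def)
qed

lemma ex_projective_resolution:
  assumes "X \<in> Obj C"
  shows "\<exists>P d. projective_resolution C X P d"
proof -
  obtain P0 e where e: "projective C P0" "e \<in> homset C P0 X" "epic C e" using projective_cover[OF assms] .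
  \<comment> \<open>The choice runs over arrows only; the objects of the resolution are recovered as
    their domains. The clause for \<open>i = 0\<close> pins down the augmentation.\<close>
  have "\<exists>d. \<forall>i. (d i \<in> Arr C \<and> projective C (Dom C (d i)) \<and>
      (i = 0 \<longrightarrow> Cod C (d i) = X \<and> epic C (d i))) \<and>
    Cod C (d (Suc i)) = Dom C (d i) \<and> exact C (d (Suc i)) (d i)"
  proof (rule dependent_nat_choice[where
        P = "\<lambda>i d. d \<in> Arr C \<and> projective C (Dom C d) \<and> (i = 0 \<longrightarrow> Cod C d = X \<and> epic C d)"
        and Q = "\<lambda>i d d'. Cod C d' = Dom C d \<and> exact C d' d"])
    show "\<exists>d. d \<in> Arr C \<and> projective C (Dom C d) \<and> ((0::nat) = 0 \<longrightarrow> Cod C d = X \<and> epic C d)"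
      using e by (auto simp: homset_def)
    fix d :: 'b and i :: nat
    assume "d \<in> Arr C \<and> projective C (Dom C d) \<and> (i = 0 \<longrightarrow> Cod C d = X \<and> epic C d)"
    then obtain d' where "d' \<in> Arr C" "Cod C d' = Dom C d" "projective C (Dom C d')" "exact C d' d"
      using exact_step by blast
    then show "\<exists>d'. (d' \<in> Arr C \<and> projective C (Dom C d') \<and> (Suc i = 0 \<longrightarrow> Cod C d' = X \<and> epic C d')) \<and>
        Cod C d' = Dom C d \<and> exact C d' d"
      by simp blast
  qed
  then obtain d where d: "\<And>i. d i \<in> Arr C \<and> projective C (Dom C (d i)) \<and>
      (i = 0 \<longrightarrow> Cod C (d i) = X \<and> epic C (d i))"
    and d_Suc: "\<And>i. Cod C (d (Suc i)) = Dom C (d i) \<and> exact C (d (Suc i)) (d i)"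
    by blast
  obtain Z where Z: "zero_object C Z" using ex_zero_object by blast
  have "exact C (d 0) (Zero C X Z)"
    using exact_to_zero_iff[OF _ Z, of "d 0" "Dom C (d 0)" X] d[of 0] by (simp add: homset_def)
  then have "projective_resolution C X (\<lambda>i. Dom C (d i)) d"
    using d d_Suc Z unfolding projective_resolution_def by (auto simp: homset_def)
  then show ?thesis by blast
qed

text \<open>Composing with a monic does not change which elements are annihilated, so
  \<open>e\<close> and \<open>g\<close> have the same kernel.\<close>

lemma exact_monic_factor:
  assumes "exact C f g" "f \<in> homset C X Y" "e \<in> homset C Y K" "m \<in> homset C K W" "m \<cdot> e = g" "monic C m"
  shows "exact C f e"
proof (rule exactI[OF assms(2,3)])
  have g: "g \<in> homset C Y W" using assms(3-5) comp_hom by blast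
  have ob: "W \<in> Obj C" using g homset_objs by blast
  have "m \<cdot> (e \<cdot> f) = Zero C X W"
    using exact_comp_zero[OF assms(1,2) g] comp_ext[OF assms(5), of f] assms(2-4) by (simp add: homset_def)
  then show "e \<cdot> f = Zero C X K" using monic_comp_zeroD[OF assms(6,4) comp_hom[OF assms(2,3)]] by blast
  fix T x assume x: "projective C T" "x \<in> homset C T Y" "e \<cdot> x = Zero C T K"
  have T: "T \<in> Obj C" using x homset_objs by blast
  have "g \<cdot> x = m \<cdot> (e \<cdot> x)" using comp_ext[OF assms(5), of x] x(2) assms(3,4) by (simp add: homset_def)
  also have "\<dots> = Zero C T W" unfolding x(3) using assms(4) T by (simp add: additive_simps)
  finally show "\<exists>y \<in> homset C T X. f \<cdot> y = x" using exact_lift[OF assms(1,2) g x(1,2)] by blast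
qed

lemma exact_monic_comp:
  assumes "exact C f e" "f \<in> homset C X Y" "e \<in> homset C Y K" "m \<in> homset C K W" "monic C m"
  shows "exact C f (m \<cdot> e)"
proof (rule exactI[OF assms(2) comp_hom[OF assms(3,4)]])
  have ob: "X \<in> Obj C" using assms(2) homset_objs by blast
  have "m \<cdot> e \<cdot> f = m \<cdot> (e \<cdot> f)" using assms(2-4) by (simp add: additive_simps)
  then show "m \<cdot> e \<cdot> f = Zero C X W"
    unfolding exact_comp_zero[OF assms(1-3)] using assms(4) ob by (simp add: additive_simps)
  fix T x assume x: "projective C T" "x \<in> homset C T Y" "m \<cdot> e \<cdot> x = Zero C T W"
  have "m \<cdot> (e \<cdot> x) = Zero C T W" using x assms(3,4) by (simp add: additive_simps)
  then have "e \<cdot> x = Zero C T K" using monic_comp_zeroD[OF assms(5,4) comp_hom[OF x(2) assms(3)]] by blast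
  then show "\<exists>y \<in> homset C T X. f \<cdot> y = x" using exact_lift[OF assms(1-3) x(1,2)] by blast
qed

lemma exact_epic_comp:
  assumes "ses K k A e Y" "f \<in> homset C X K" "epic C f"
  shows "exact C (k \<cdot> f) e"
proof -
  note S = sesD[OF assms(1)]
  show ?thesis
  proof (rule exactI[OF comp_hom[OF assms(2) S(1)] S(2)])
    have "e \<cdot> (k \<cdot> f) = Zero C K Y \<cdot> f" using comp_ext[OF S(4), of f] S(1,2) assms(2) by (simp add: homset_def)
    then show "e \<cdot> (k \<cdot> f) = Zero C X Y" using assms(2) S by (simp add: additive_simps)
    fix T x assume x: "projective C T" "x \<in> homset C T A" "e \<cdot> x = Zero C T Y"
    obtain y where y: "y \<in> homset C T K" "k \<cdot> y = x" using ses_lift[OF assms(1) x(2,3)] .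
    obtain z where z: "z \<in> homset C T X" "f \<cdot> z = y" using projective_lift[OF x(1) assms(3,2) y(1)] .
    have "k \<cdot> f \<cdot> z = x" using z y(2) assms(2) S by (simp add: additive_simps)
    then show "\<exists>z \<in> homset C T X. k \<cdot> f \<cdot> z = x" using z by blast
  qed
qed

text \<open>Cuts the resolution at its first syzygy \<open>K\<close>. The differential out of degree
  1 factors as \<open>m \<cdot> e\<close>; \<open>case_nat\<close> makes \<open>e\<close> the new
  augmentation and puts the old differential of index \<open>i + 2\<close> at index
  \<open>i + 1\<close>.\<close>

lemma projective_resolution_tail:
  assumes "projective_resolution C X P d"
  obtains K m e where "ses K m (P 0) (d 0) X" "e \<in> homset C (P (Suc 0)) K" "epic C e" "m \<cdot> e = d (Suc 0)"
    "exact C (d (Suc (Suc 0))) e"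
    "projective_resolution C K (\<lambda>i. P (Suc i)) (case_nat e (\<lambda>i. d (Suc (Suc i))))"
proof -
  have P: "\<And>i. projective C (P i)" and d0: "d 0 \<in> homset C (P 0) X"
    and d: "\<And>i. d (Suc i) \<in> homset C (P (Suc i)) (P i)" and ex: "\<And>i. exact C (d (Suc i)) (d i)"
    using assms by (auto simp: projective_resolution_def)
  obtain Z where Z: "zero_object C Z" "exact C (d 0) (Zero C X Z)"
    using assms by (auto simp: projective_resolution_def)
  then have "epic C (d 0)" using exact_to_zero_iff d0 by blast
  then obtain K m where K: "ses K m (P 0) (d 0) X" using epic_ses d0 by blast
  note S = sesD[OF K]
  have dm: "Dom C m = K" using S by (simp add: homset_def)
  obtain e where e: "e \<in> homset C (P (Suc 0)) K" "m \<cdot> e = d (Suc 0)" "epic C e"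
    using exact_kernel_factorization[OF ex d d0 S(6)] unfolding dm .
  have ex': "exact C (d (Suc (Suc 0))) e" using exact_monic_factor[OF ex d e(1) S(1) e(2) S(5)] .
  have "exact C e (Zero C K Z)" using exact_to_zero_iff[OF e(1) Z(1)] e(3) by blast
  then have "projective_resolution C K (\<lambda>i. P (Suc i)) (case_nat e (\<lambda>i. d (Suc (Suc i))))"
    unfolding projective_resolution_def using P d ex ex' e(1) Z(1) by (auto split: nat.split)
  then show ?thesis using that K e ex' by blast
qed

text \<open>Each unfolding of \<open>ext_vanish\<close> drops one term of the resolution. In degree
  0, cocycles on \<open>P 1\<close> are the maps \<open>f' \<cdot> e\<close> with \<open>f'\<close>
  on \<open>K\<close>, because \<open>e\<close> is epic and \<open>d 2\<close> covers its kernel.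
  The coboundary of \<open>g\<close> is \<open>(g \<cdot> m) \<cdot> e\<close>, and \<open>e\<close>
  can be cancelled.\<close>

lemma ext_vanish_iff_resolution:
  assumes "projective_resolution C X P d" "Y \<in> Obj C"
  shows "ext_vanish i X Y \<longleftrightarrow>
    (\<forall>f \<in> homset C (P (Suc i)) Y. f \<cdot> d (Suc (Suc i)) = Zero C (P (Suc (Suc i))) Y \<longrightarrow>
      (\<exists>g \<in> homset C (P i) Y. g \<cdot> d (Suc i) = f))"
  using assms(1)
proof (induction i arbitrary: X P d)
  case 0
  obtain K m e where K: "ses K m (P 0) (d 0) X" "e \<in> homset C (P (Suc 0)) K" "epic C e"
    "m \<cdot> e = d (Suc 0)" "exact C (d (Suc (Suc 0))) e"
    using projective_resolution_tail[OF 0] by metis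
  note S = sesD[OF K(1)]
  have P: "projective C (P 0)" and d2: "d (Suc (Suc 0)) \<in> homset C (P (Suc (Suc 0))) (P (Suc 0))"
    using 0 by (auto simp: projective_resolution_def)
  have gd: "g \<cdot> d (Suc 0) = g \<cdot> m \<cdot> e" if "g \<in> homset C (P 0) Y" for g
    unfolding K(4)[symmetric] using that K(2) S by (simp add: additive_simps)
  show ?case
    unfolding ext_vanish_0_iff[OF P K(1)]
  proof (intro iffI ballI impI)
    fix f assume ext: "\<forall>f\<in>homset C K Y. \<exists>g\<in>homset C (P 0) Y. g \<cdot> m = f"
      and f: "f \<in> homset C (P (Suc 0)) Y" "f \<cdot> d (Suc (Suc 0)) = Zero C (P (Suc (Suc 0))) Y"
    obtain f' where f': "f' \<in> homset C K Y" "f' \<cdot> e = f"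
    proof (rule epic_factorization[OF K(3,2) f(1)])
      fix T x assume x: "projective C T" "x \<in> homset C T (P (Suc 0))" "e \<cdot> x = Zero C T K"
      obtain y where y: "y \<in> homset C T (P (Suc (Suc 0)))" "d (Suc (Suc 0)) \<cdot> y = x"
        using exact_lift[OF K(5) d2 K(2) x] .
      have "f \<cdot> x = Zero C (P (Suc (Suc 0))) Y \<cdot> y"
        unfolding y(2)[symmetric] using comp_ext[OF f(2), of y] y(1) f(1) d2 by (simp add: homset_def)
      then show "f \<cdot> x = Zero C T Y" using y(1) assms(2) by (simp add: additive_simps)
    qed
    then show "\<exists>g \<in> homset C (P 0) Y. g \<cdot> d (Suc 0) = f" using ext gd by metis
  next
    fix f assume ext: "\<forall>f\<in>homset C (P (Suc 0)) Y. f \<cdot> d (Suc (Suc 0)) = Zero C (P (Suc (Suc 0))) Y \<longrightarrow>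
        (\<exists>g\<in>homset C (P 0) Y. g \<cdot> d (Suc 0) = f)"
      and f: "f \<in> homset C K Y"
    have "f \<cdot> e \<cdot> d (Suc (Suc 0)) = f \<cdot> (e \<cdot> d (Suc (Suc 0)))"
      using f K(2) d2 by (simp add: additive_simps)
    also have "\<dots> = Zero C (P (Suc (Suc 0))) Y"
      unfolding exact_comp_zero[OF K(5) d2 K(2)] using f homset_objs[OF d2] by (simp add: additive_simps)
    finally obtain g where g: "g \<in> homset C (P 0) Y" "g \<cdot> d (Suc 0) = f \<cdot> e"
      using ext comp_hom[OF K(2) f] by blast
    then have "g \<cdot> m = f" using epicD[OF K(3) comp_hom[OF S(1) g(1)] f K(2)] gd by simp
    then show "\<exists>g\<in>homset C (P 0) Y. g \<cdot> m = f" using g by blast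
  qed
next
  case (Suc i)
  obtain K m e where K: "ses K m (P 0) (d 0) X"
    "projective_resolution C K (\<lambda>i. P (Suc i)) (case_nat e (\<lambda>i. d (Suc (Suc i))))"
    using projective_resolution_tail[OF Suc.prems] by metis
  have P: "projective C (P 0)" using Suc.prems by (auto simp: projective_resolution_def)
  show ?case unfolding ext_vanish_Suc_iff[OF P K(1)] Suc.IH[OF K(2)] by simp
qed

text \<open>Since a projective resolution exists, \<open>SOME\<close> returns one, and any
  resolution decides \<open>ext_vanish\<close>.\<close>

lemma trivial_Ext_iff:
  assumes "X \<in> Obj C" "Y \<in> Obj C"
  shows "trivial_group (Ext C (Suc i) X Y) \<longleftrightarrow> ext_vanish i X Y"
proof -
  define R where "R = (SOME (P, d). projective_resolution C X P d)"
  obtain P d where R: "R = (P, d)" by (rule prod.exhaust)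
  have "\<exists>x. case_prod (projective_resolution C X) x"
    using ex_projective_resolution[OF assms(1)] by auto
  then have "case_prod (projective_resolution C X) R" unfolding R_def by (rule someI_ex)
  then have res: "projective_resolution C X P d" by (simp add: R)
  then have d: "d (Suc j) \<in> homset C (P (Suc j)) (P j)" and ex: "exact C (d (Suc (Suc j))) (d (Suc j))" for j
    by (auto simp: projective_resolution_def)
  have "Ext C (Suc i) X Y = cohomology C P d Y (Suc i)"
    using R unfolding Ext_def R_def by simp
  then show ?thesis
    using trivial_cohomology_iff[of d P, OF d exact_comp_zero[OF ex d d] assms(2)]
      ext_vanish_iff_resolution[OF res assms(2)] by simp
qed

lemma left_perp_iff:
  assumes "\<B> \<subseteq> Obj C"
  shows "X \<in> left_perp C (Suc i) \<B> \<longleftrightarrow> X \<in> Obj C \<and> (\<forall>Y \<in> \<B>. ext_vanish i X Y)"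
proof -
  have "trivial_group (Ext C (Suc i) X Y) \<longleftrightarrow> ext_vanish i X Y" if "X \<in> Obj C" "Y \<in> \<B>" for Y
    using that assms by (intro trivial_Ext_iff) auto
  then show ?thesis by (auto simp: left_perp_def Ext_vanishes_def)
qed

section \<open>Finite resolutions by objects of a class\<close>

text \<open>Length 0 provides an isomorphism from a member of \<open>\<X>\<close>, not membership of
  \<open>Y\<close>: \<open>\<X>\<close> is not assumed closed under isomorphism.\<close>

lemma has_resolution_0D:
  assumes "has_resolution C \<X> Y 0"
  obtains X f where "X \<in> \<X>" "f \<in> homset C X Y" "monic C f" "epic C f"
proof -
  obtain X :: "nat \<Rightarrow> 'a" and d :: "nat \<Rightarrow> 'b" and Z where X: "X 0 \<in> \<X>" and Z: "zero_object C Z" and d: "d 0 \<in> homset C (X 0) Y"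
    and ep: "exact C (d 0) (Zero C Y Z)" and mo: "exact C (Zero C Z (X 0)) (d 0)"
    using assms unfolding has_resolution_def by blast
  show ?thesis
    using that[OF X d] ep mo exact_to_zero_iff[OF d Z] exact_from_zero_iff[OF d Z] by simp
qed

lemma has_resolution_tail:
  assumes "has_resolution C \<X> Y (Suc m)"
  obtains K k A e where "A \<in> \<X>" "ses K k A e Y" "has_resolution C \<X> K m"
proof -
  obtain X d Z where X: "\<And>j. j \<le> Suc m \<Longrightarrow> X j \<in> \<X>" and Z: "zero_object C Z"
    and d0: "d 0 \<in> homset C (X 0) Y"
    and d: "\<And>j. j < Suc m \<Longrightarrow> d (Suc j) \<in> homset C (X (Suc j)) (X j)"
    and ep: "exact C (d 0) (Zero C Y Z)" and ex: "\<And>j. j < Suc m \<Longrightarrow> exact C (d (Suc j)) (d j)"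
    and mo: "exact C (Zero C Z (X (Suc m))) (d (Suc m))"
    using assms unfolding has_resolution_def by blast
  have "epic C (d 0)" using ep exact_to_zero_iff d0 Z by blast
  then obtain K k where K: "ses K k (X 0) (d 0) Y" using epic_ses d0 by blast
  note S = sesD[OF K]
  have dk: "Dom C k = K" using S by (simp add: homset_def)
  obtain e where e: "e \<in> homset C (X (Suc 0)) K" "k \<cdot> e = d (Suc 0)" "epic C e"
    using exact_kernel_factorization[OF ex d d0 S(6)] unfolding dk by blast
  have ex1: "exact C e (Zero C K Z)" using exact_to_zero_iff[OF e(1) Z] e(3) by blast
  have ex2: "exact C (d (Suc (Suc 0))) e" if "0 < m"
    using that exact_monic_factor[OF ex d e(1) S(1) e(2) S(5)] by simp
  \<comment> \<open>For \<open>m = 0\<close> the last map of the given sequence is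
    \<open>k \<cdot> e\<close>, and its monicity passes to \<open>e\<close>, the only map
    left.\<close>
  have mo0: "exact C (Zero C Z (X (Suc 0))) e" if "m = 0"
    using exact_monic_factor[OF _ zero_hom e(1) S(1) e(2) S(5)] mo that zero_object_obj[OF Z]
      homset_objs[OF e(1)] by simp
  let ?d = "case_nat e (\<lambda>i. d (Suc (Suc i)))" and ?X = "\<lambda>j. X (Suc j)"
  have "has_resolution C \<X> K m"
    unfolding has_resolution_def
  proof (rule exI[of _ ?X], rule exI[of _ ?d], rule exI[of _ Z], intro conjI allI impI)
    show "?X j \<in> \<X>" if "j \<le> m" for j using X that by simp
    show "zero_object C Z" "?d 0 \<in> homset C (?X 0) K" "exact C (?d 0) (Zero C K Z)"
      using Z e(1) ex1 by simp_all
    show "?d (Suc j) \<in> homset C (?X (Suc j)) (?X j)" if "j < m" for j using d that by simp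
    show "exact C (?d (Suc j)) (?d j)" if "j < m" for j using ex ex2 that by (cases j) simp_all
    show "exact C (Zero C Z (?X m)) (?d m)" using mo mo0 by (cases m) simp_all
  qed
  then show ?thesis using that X K by blast
qed

lemma has_resolution_0I:
  assumes "X \<in> \<X>" "X \<in> Obj C"
  shows "has_resolution C \<X> X 0"
proof -
  obtain Z where Z: "zero_object C Z" using ex_zero_object by blast
  have id: "Id C X \<in> homset C X X" using id_hom[OF assms(2)] .
  show ?thesis
    unfolding has_resolution_def
    using assms Z id exact_to_zero_iff[OF id Z] exact_from_zero_iff[OF id Z] id_epic id_monic
    by (intro exI[of _ "\<lambda>_. X"] exI[of _ "\<lambda>_. Id C X"] exI[of _ Z]) simp
qed

text \<open>Splices the resolution of \<open>K\<close> onto the sequence at \<open>K\<close>: the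
  augmentation followed by the inclusion, \<open>k \<cdot> d 0\<close>, becomes the differential of
  index 1.\<close>

lemma has_resolution_SucI:
  assumes "has_resolution C \<X> K m" "ses K k A e Y" "A \<in> \<X>"
  shows "has_resolution C \<X> Y (Suc m)"
proof -
  obtain X d Z where X: "\<And>j. j \<le> m \<Longrightarrow> X j \<in> \<X>" and Z: "zero_object C Z"
    and d0: "d 0 \<in> homset C (X 0) K"
    and d: "\<And>j. j < m \<Longrightarrow> d (Suc j) \<in> homset C (X (Suc j)) (X j)"
    and ep: "exact C (d 0) (Zero C K Z)" and ex: "\<And>j. j < m \<Longrightarrow> exact C (d (Suc j)) (d j)"
    and mo: "exact C (Zero C Z (X m)) (d m)"
    using assms(1) unfolding has_resolution_def by blast
  note S = sesD[OF assms(2)]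
  have ep0: "epic C (d 0)" using ep exact_to_zero_iff[OF d0 Z] by blast
  have ex0: "exact C (k \<cdot> d 0) e" using exact_epic_comp[OF assms(2) d0 ep0] .
  have ex1: "exact C (d (Suc 0)) (k \<cdot> d 0)" if "0 < m"
    using exact_monic_comp[OF ex d d0 S(1,5)] that by blast
  have mo0: "exact C (Zero C Z (X 0)) (k \<cdot> d 0)" if "m = 0"
    using exact_monic_comp[OF _ zero_hom d0 S(1,5)] mo that zero_object_obj[OF Z] homset_objs[OF d0]
    by simp
  let ?d = "case_nat e (case_nat (k \<cdot> d 0) (\<lambda>i. d (Suc i)))" and ?X = "case_nat A X"
  show ?thesis
    unfolding has_resolution_def
  proof (rule exI[of _ ?X], rule exI[of _ ?d], rule exI[of _ Z], intro conjI allI impI)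
    show "?X j \<in> \<X>" if "j \<le> Suc m" for j using X assms(3) that by (cases j) simp_all
    show "zero_object C Z" "?d 0 \<in> homset C (?X 0) Y" using Z S(2) by simp_all
    show "exact C (?d 0) (Zero C Y Z)" using exact_to_zero_iff[OF S(2) Z] S(3) by simp
    show "?d (Suc j) \<in> homset C (?X (Suc j)) (?X j)" if "j < Suc m" for j
      using d that comp_hom[OF d0 S(1)] by (cases j) simp_all
    show "exact C (?d (Suc j)) (?d j)" if "j < Suc m" for j
    proof (cases j)
      case (Suc i)
      then show ?thesis using ex ex1 that by (cases i) simp_all
    qed (use ex0 in simp)
    show "exact C (Zero C Z (?X (Suc m))) (?d (Suc m))" using mo mo0 by (cases m) simp_all
  qed
qed

text \<open>Dimension shifting along the resolution: vanishing on \<open>K\<close> one degree lower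
  and on \<open>A\<close> in the same degree gives vanishing on \<open>X\<close>. The bound
  \<open>m \<le> j\<close> ensures that a degree is left to lower at each step.\<close>

lemma ext_vanish_resolution:
  "\<lbrakk>has_resolution C \<X> X m; m \<le> j; \<And>A i. A \<in> \<X> \<Longrightarrow> i \<le> j \<Longrightarrow> ext_vanish i A Y\<rbrakk> \<Longrightarrow> ext_vanish j X Y"
proof (induction m arbitrary: X j)
  case 0
  obtain A f where A: "A \<in> \<X>" "f \<in> homset C A X" "monic C f" "epic C f"
    using has_resolution_0D[OF 0(1)] .
  obtain r where r: "r \<in> homset C X A" "f \<cdot> r = Id C X" using monic_epic_iso[OF A(3,4,2)] .
  show ?case
    using ext_vanish_stable_retract[OF retract_stable_retract[OF r(1) A(2) r(2)]] 0(3) A(1) by blast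
next
  case (Suc m)
  obtain K k A e where A: "A \<in> \<X>" "ses K k A e X" "has_resolution C \<X> K m"
    using has_resolution_tail[OF Suc.prems(1)] .
  obtain i where i: "j = Suc i" "m \<le> i" using Suc.prems(2) by (cases j) auto
  have "ext_vanish i K Y" using Suc.IH[OF A(3) i(2)] Suc.prems(3) i(1) by simp
  then show ?case using ext_vanish_right[OF A(2)] Suc.prems(3)[OF A(1)] i(1) by blast
qed

text \<open>A projective cover lies in \<open>left_perp C 1 \<B>\<close>, and its kernel is
  orthogonal one degree lower than \<open>X\<close>; after \<open>k\<close> steps the last kernel is
  orthogonal in degree 1.\<close>

lemma resolution_by_left_perp:
  assumes "\<B> \<subseteq> Obj C"
  shows "X \<in> left_perp C (Suc k) \<B> \<Longrightarrow> has_resolution C (left_perp C 1 \<B>) X k"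
proof (induction k arbitrary: X)
  case 0
  then show ?case using has_resolution_0I left_perp_iff[OF assms] by simp
next
  case (Suc k)
  have X: "X \<in> Obj C" "\<And>Y. Y \<in> \<B> \<Longrightarrow> ext_vanish (Suc k) X Y" using Suc.prems left_perp_iff[OF assms] by blast+
  obtain K m P e where P: "projective C P" "ses K m P e X" using projective_ses[OF X(1)] .
  have "ext_vanish 0 P Y" if "Y \<in> \<B>" for Y
    using ext_vanish_projective[OF P(1)] that assms by blast
  then have "P \<in> left_perp C 1 \<B>" using left_perp_iff[OF assms, of P 0] sesD(8)[OF P(2)] by simp
  moreover have "K \<in> left_perp C (Suc k) \<B>"
    using left_perp_iff[OF assms] X(2) ext_vanish_Suc_iff[OF P] sesD[OF P(2)] by blast
  ultimately show ?case using has_resolution_SucI[OF Suc.IH P(2)] by blast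
qed

section \<open>Precovers with the unique mapping property\<close>

text \<open>The isomorphism is recorded as a stable retraction, the relation along which
  \<open>ext_vanish\<close> passes from \<open>D\<close> to \<open>X\<close>.\<close>

lemma unique_precover_retract:
  assumes "precover C \<X> X f" "unique_mapping_property C \<X> X f" "\<And>P. projective C P \<Longrightarrow> P \<in> \<X>"
  shows "\<exists>D \<in> \<X>. stable_retract X D"
proof -
  define D where "D = Dom C f"
  have f: "f \<in> homset C D X" and D: "D \<in> \<X>"
    and lift: "\<And>T x. T \<in> \<X> \<Longrightarrow> x \<in> homset C T X \<Longrightarrow> \<exists>h \<in> homset C T D. x = f \<cdot> h"
    using assms(1) unfolding precover_def D_def homset_def by blast+
  have ob: "D \<in> Obj C" "X \<in> Obj C" using f homset_objs by blast+
  have "epic C f"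
    using epicI_projective[OF f] lift assms(3) by metis
  moreover have "monic C f"
  proof (rule monicI_projective[OF f])
    fix T x assume x: "projective C T" "x \<in> homset C T D" "f \<cdot> x = Zero C T X"
    have T: "T \<in> Obj C" using x homset_objs by blast
    have z: "f \<cdot> Zero C T D = Zero C T X" using f T by (simp add: additive_simps)
    \<comment> \<open>Both \<open>x\<close> and the zero morphism lift the zero morphism to
      \<open>X\<close>, so they coincide.\<close>
    have "\<exists>!h. h \<in> homset C T D \<and> Zero C T X = f \<cdot> h"
      using assms(2,3) x(1) zero_hom[OF T ob(2)] unfolding unique_mapping_property_def D_def by blast
    then show "x = Zero C T D" using x(2,3) zero_hom[OF T ob(1)] z by metis
  qed
  ultimately obtain r where "r \<in> homset C X D" "f \<cdot> r = Id C X" using monic_epic_iso f by blast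
  then show ?thesis using retract_stable_retract f D by blast
qed

lemma id_precover:
  assumes "X \<in> \<X>" "X \<in> Obj C"
  shows "precover C \<X> X (Id C X)" "unique_mapping_property C \<X> X (Id C X)"
proof -
  have id: "f = Id C X \<cdot> h \<longleftrightarrow> h = f" if "h \<in> homset C T X" for T f h
    using id_comp[OF that] by auto
  show "precover C \<X> X (Id C X)"
    using assms id id_arr[OF assms(2)] unfolding precover_def by auto
  show "unique_mapping_property C \<X> X (Id C X)"
    using id id_arr[OF assms(2)] unfolding unique_mapping_property_def by auto
qed

lemma precover_left_perp:
  assumes "\<B> \<subseteq> Obj C" "precover C (left_perp C (Suc k) \<B>) X f"
    "unique_mapping_property C (left_perp C (Suc k) \<B>) X f"
  shows "X \<in> left_perp C (Suc k) \<B>"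
proof -
  have "P \<in> left_perp C (Suc k) \<B>" if "projective C P" for P
    using left_perp_iff[OF assms(1)] ext_vanish_projective[OF that] that assms(1)
    by (auto simp: projective_def)
  then obtain D where D: "D \<in> left_perp C (Suc k) \<B>" "stable_retract X D"
    using unique_precover_retract[OF assms(2,3)] by blast
  have "X \<in> Obj C" using assms(2) cod_obj unfolding precover_def by blast
  then show ?thesis using D ext_vanish_stable_retract left_perp_iff[OF assms(1)] by blast
qed

end

theorem corollary3p15:
  fixes C :: "('o, 'm) precat" and \<A> \<B> :: "'o set" and n k :: nat
  assumes "n \<ge> 1"
    and "abelian_category C"
    and "enough_projectives C"
    and "left_cotorsion_pair C n \<A> \<B>"
    and "\<A> = left_perp C 1 \<B>"
    and "k \<le> n - 1"
  shows "((\<forall>X \<in> Obj C. \<exists>f. precover C (left_perp C (k + 1) \<B>) X f \<and>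
             unique_mapping_property C (left_perp C (k + 1) \<B>) X f) \<longleftrightarrow>
          (\<forall>X \<in> Obj C. resdim C \<A> X \<le> enat k)) \<and>
         ((\<forall>X \<in> Obj C. resdim C \<A> X \<le> enat k) \<longleftrightarrow>
          Obj C = left_perp C (k + 1) \<B>)"
proof -
  interpret abelian_category C by (rule assms(2))
  interpret abelian_enough_projectives C by unfold_locales (rule assms(3))
  have B: "\<B> \<subseteq> Obj C" and A: "\<A> \<subseteq> Obj C"
    and vanish: "\<And>i. 1 \<le> i \<Longrightarrow> i \<le> n \<Longrightarrow> Ext_vanishes C i \<A> \<B>"
    using assms(4) unfolding left_cotorsion_pair_def by blast+
  have sub: "left_perp C (k + 1) \<B> \<subseteq> Obj C" by (auto simp: left_perp_def)
  have ext_A: "ext_vanish i X Y" if "X \<in> \<A>" "Y \<in> \<B>" "i \<le> k" for X Y i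
  proof -
    \<comment> \<open>The degree is at most \<open>k + 1\<close>, and \<open>k + 1 \<le> n\<close>
      by \<open>k \<le> n - 1\<close> together with \<open>n \<ge> 1\<close>.\<close>
    have "Ext_vanishes C (Suc i) \<A> \<B>" using that(3) assms(1,6) by (intro vanish) auto
    then have "trivial_group (Ext C (Suc i) X Y)" using that unfolding Ext_vanishes_def by blast
    moreover have "X \<in> Obj C" "Y \<in> Obj C" using that A B by auto
    ultimately show ?thesis using trivial_Ext_iff by simp
  qed
  have bc: "Obj C = left_perp C (k + 1) \<B>" if b: "\<forall>X \<in> Obj C. resdim C \<A> X \<le> enat k"
  proof -
    have "X \<in> left_perp C (k + 1) \<B>" if X: "X \<in> Obj C" for X
    proof -
      \<comment> \<open>The dimension is an infimum; the strict bound by \<open>Suc k\<close> allows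
        \<open>Inf_less_iff\<close> to extract an actual resolution, of length at most
        \<open>k\<close>.\<close>
      have "resdim C \<A> X < enat (Suc k)"
        using b X by (metis enat_ord_simps(2) le_less_trans lessI)
      then obtain m where m: "has_resolution C \<A> X m" "m \<le> k"
        unfolding resdim_def Inf_less_iff by auto
      have "ext_vanish k X Y" if "Y \<in> \<B>" for Y
        using ext_vanish_resolution[OF m] ext_A that by blast
      then show ?thesis using left_perp_iff[OF B, of X k] X by simp
    qed
    then show ?thesis using sub by blast
  qed
  \<comment> \<open>The resolution of length \<open>k\<close> is by objects of
    \<open>left_perp C 1 \<B>\<close>, which is \<A> by hypothesis, and its length bounds the
    infimum.\<close>
  have cb: "resdim C \<A> X \<le> enat k" if "Obj C = left_perp C (k + 1) \<B>" "X \<in> Obj C" for X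
    using resolution_by_left_perp[OF B, of X k] that assms(5) unfolding resdim_def
    by (auto intro: Inf_lower)
  have "(\<forall>X \<in> Obj C. \<exists>f. precover C (left_perp C (k + 1) \<B>) X f \<and>
      unique_mapping_property C (left_perp C (k + 1) \<B>) X f) \<longleftrightarrow> Obj C = left_perp C (k + 1) \<B>"
    using precover_left_perp[OF B, of k] id_precover sub by (metis Suc_eq_plus1 subsetI subset_antisym)
  then show ?thesis using bc cb by blast
qed

end
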